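(* For any $\epsilon\in(0,1/2]$, any (possibly randomized, Monte Carlo) distributed algorithm in the $\mathsf{HYBRID}$ model that determines a $(3/2-\epsilon)$-approximation of the radius of a weighted graph with probability at least $2/3$ requires $\widetilde{\Omega}(n^{1/3})$ rounds. Moreover, any such algorithm that determines the (exact) radius of an unweighted graph with probability at least $2/3$ requires $\widetilde{\Omega}(n^{1/3})$ rounds.
   Context: Distributed setting: $n$ nodes with unique IDs in $\{1,\dots,n\}$; local communication graph $G=(V,E,w)$, undirected, with integer edge weights in $\{1,\dots,W\}$; each node initially knows only its neighbors' IDs and incident edge weights; synchronous rounds, unlimited local computation. In the $\mathsf{HYBRID}$ model, in every round each node may send a message of arbitrary size to each neighbor in $G$ (local mode) and may additionally send and receive $\mathcal{O}(\log n)$-bit messages to/from up to $\mathcal{O}(\log n)$ arbitrary nodes (global mode, node-capacitated clique); excess messages are dropped arbitrarily. The eccentricity of a node $u$ is $\mathrm{ecc}(u)=\max_v d(u,v)$ and the radius is $R=\min_u \mathrm{ecc}(u)$. An $\alpha$-approximation of the radius is a value $\widetilde R$ with $R\le \widetilde R\le \alpha R$. $\widetilde{\Omega}(\cdot)$ hides polylogarithmic factors in $n$. *)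

theory Defs
  imports "HOL-Probability.Probability"
begin

text \<open>A graph on the nodes {1..n} is given by a weight function w: w u v = 0 means
  that u and v are not adjacent, otherwise w u v is the (positive integer) weight
  of the undirected edge {u,v}.\<close>

definition wgraph :: "nat \<Rightarrow> (nat \<Rightarrow> nat \<Rightarrow> nat) \<Rightarrow> bool" where
  "wgraph n w \<longleftrightarrow> (\<forall>u v. w u v = w v u) \<and> (\<forall>u. w u u = 0) \<and>
     (\<forall>u v. 0 < w u v \<longrightarrow> u \<in> {1..n} \<and> v \<in> {1..n})"

definition is_path :: "(nat \<Rightarrow> nat \<Rightarrow> nat) \<Rightarrow> nat \<Rightarrow> nat \<Rightarrow> nat list \<Rightarrow> bool" where
  "is_path w u v p \<longleftrightarrow> p \<noteq> [] \<and> hd p = u \<and> last p = v \<and>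
     (\<forall>i < length p - 1. 0 < w (p ! i) (p ! Suc i))"

definition path_weight :: "(nat \<Rightarrow> nat \<Rightarrow> nat) \<Rightarrow> nat list \<Rightarrow> nat" where
  "path_weight w p = (\<Sum>i < length p - 1. w (p ! i) (p ! Suc i))"

definition connected_graph :: "nat \<Rightarrow> (nat \<Rightarrow> nat \<Rightarrow> nat) \<Rightarrow> bool" where
  "connected_graph n w \<longleftrightarrow> (\<forall>u\<in>{1..n}. \<forall>v\<in>{1..n}. \<exists>p. is_path w u v p)"

definition gdist :: "(nat \<Rightarrow> nat \<Rightarrow> nat) \<Rightarrow> nat \<Rightarrow> nat \<Rightarrow> nat" where
  "gdist w u v = (LEAST k. \<exists>p. is_path w u v p \<and> path_weight w p = k)"

definition ecc :: "nat \<Rightarrow> (nat \<Rightarrow> nat \<Rightarrow> nat) \<Rightarrow> nat \<Rightarrow> nat" where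
  "ecc n w u = Max ((\<lambda>v. gdist w u v) ` {1..n})"

definition radius :: "nat \<Rightarrow> (nat \<Rightarrow> nat \<Rightarrow> nat) \<Rightarrow> nat" where
  "radius n w = Min (ecc n w ` {1..n})"

text \<open>An algorithm (for a fixed number n of nodes).  Each node draws private randomness
  from coins (its own ID); its initial state depends on n, its ID, its local view
  (neighbour IDs and incident weights, given as the function v |-> w u v) and its random
  seed.  In each round a node sends an arbitrary local message to every neighbour, and a
  list of global messages (target ID, bit string); then it computes its new state from
  the local messages received from its neighbours and the list of global messages
  (sender ID, bit string) delivered to it.  After the last round every node outputs a value.\<close>

record ('s, 'm, 'r) hybrid_alg =
  h_coins :: "nat \<Rightarrow> 'r pmf"
  h_init :: "nat \<Rightarrow> nat \<Rightarrow> (nat \<Rightarrow> nat) \<Rightarrow> 'r \<Rightarrow> 's"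
  h_lsend :: "'s \<Rightarrow> nat \<Rightarrow> 'm"
  h_gsend :: "'s \<Rightarrow> (nat \<times> bool list) list"
  h_step :: "'s \<Rightarrow> (nat \<Rightarrow> 'm option) \<Rightarrow> (nat \<times> bool list) list \<Rightarrow> 's"
  h_output :: "'s \<Rightarrow> real"

text \<open>Global capacity: messages of at most cap bits, at most cap messages sent and
  received per node and round, where cap = ceiling (C * log2 n).\<close>

definition cap :: "real \<Rightarrow> nat \<Rightarrow> nat" where
  "cap C n = nat \<lceil>C * log 2 (real n)\<rceil>"

text \<open>Global messages delivered to node u, given the configuration cf.  Only the first
  cap messages a node sends are transmitted, messages longer than cap bits or addressed
  outside {1..n} are dropped, and the receiver keeps only cap of the messages addressed
  to it (those from the senders with smallest IDs; a specific choice of the arbitrary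
  dropping rule).\<close>

definition global_in ::
  "('s, 'm, 'r, 'z) hybrid_alg_scheme \<Rightarrow> real \<Rightarrow> nat \<Rightarrow> (nat \<Rightarrow> 's) \<Rightarrow> nat \<Rightarrow> (nat \<times> bool list) list" where
  "global_in A C n cf u =
     take (cap C n)
       (concat (map (\<lambda>v. map (\<lambda>(x, b). (v, b))
           (filter (\<lambda>(x, b). x = u \<and> length b \<le> cap C n)
              (take (cap C n) (h_gsend A (cf v))))) [1..<Suc n]))"

primrec run ::
  "('s, 'm, 'r, 'z) hybrid_alg_scheme \<Rightarrow> real \<Rightarrow> nat \<Rightarrow> (nat \<Rightarrow> nat \<Rightarrow> nat) \<Rightarrow> (nat \<Rightarrow> 'r)
    \<Rightarrow> nat \<Rightarrow> (nat \<Rightarrow> 's)" where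
  "run A C n w \<rho> 0 = (\<lambda>u. h_init A n u (\<lambda>v. w u v) (\<rho> u))"
| "run A C n w \<rho> (Suc t) =
     (\<lambda>u. h_step A (run A C n w \<rho> t u)
        (\<lambda>v. if 0 < w u v then Some (h_lsend A (run A C n w \<rho> t v) u) else None)
        (global_in A C n (run A C n w \<rho> t) u))"

definition seeds :: "('s, 'm, 'r, 'z) hybrid_alg_scheme \<Rightarrow> nat \<Rightarrow> (nat \<Rightarrow> 'r) pmf" where
  "seeds A n = Pi_pmf {1..n} undefined (h_coins A)"

definition success ::
  "('s, 'm, 'r, 'z) hybrid_alg_scheme \<Rightarrow> real \<Rightarrow> nat \<Rightarrow> (nat \<Rightarrow> nat \<Rightarrow> nat) \<Rightarrow> nat \<Rightarrow> real
    \<Rightarrow> (nat \<Rightarrow> 'r) \<Rightarrow> bool" where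
  "success A C n w T \<alpha> \<rho> \<longleftrightarrow>
     (\<forall>u\<in>{1..n}. real (radius n w) \<le> h_output A (run A C n w \<rho> T u) \<and>
                  h_output A (run A C n w \<rho> T u) \<le> \<alpha> * real (radius n w))"

definition hybrid_radius_approx ::
  "('s, 'm, 'r, 'z) hybrid_alg_scheme \<Rightarrow> real \<Rightarrow> nat \<Rightarrow> nat \<Rightarrow> nat \<Rightarrow> real \<Rightarrow> bool" where
  "hybrid_radius_approx A C n T W \<alpha> \<longleftrightarrow>
     (\<forall>w. wgraph n w \<and> connected_graph n w \<and> (\<forall>u v. w u v \<le> W) \<longrightarrow>
        measure_pmf.prob (seeds A n) {\<rho>. success A C n w T \<alpha> \<rho>} \<ge> 2/3)"

end

theory Submission
  imports Defs
begin

text \<open>An instance of set disjointness on \<open>k\<^sup>2\<close> bits is encoded at the two ends of a graph whose ends are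
  joined by \<open>2k\<close> paths of length \<open>l\<close>, with \<open>l\<close> about \<open>n\<^bsup>1/3\<^esup>\<close> and \<open>k\<close> about \<open>n\<^bsup>2/3\<^esup>\<close>. The radius is at most
  \<open>2M + l\<close> if the sets intersect and at least \<open>3M + l\<close> otherwise, where \<open>M = 1\<close> in the unweighted
  and \<open>M = n\<^sup>2\<close> in the weighted case. In at most \<open>l/2\<close> rounds the two ends interact through global
  messages only. Hence, for fixed coins, the list of all global messages, which takes one of at
  most \<open>exp (O (n T log\<^sup>2 n))\<close> values, partitions the inputs into combinatorial rectangles, and since
  disjointness needs \<open>\<Omega>(k\<^sup>2)\<close> bits of communication, \<open>n T log\<^sup>2 n\<close> is at least of order \<open>n\<^bsup>4/3\<^esup>\<close>.

  The bound for disjointness follows Bar-Yossef, Jayram, Kumar and Sivakumar, with the chain rule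
  for mutual information replaced by the level-one inequality for bounded functions on the cube.\<close>

section \<open>The level-one inequality\<close>

text \<open>Hoeffding's lemma for a fair sign, whose moment generating function stands on the left.
  The logarithmic form with probability \<open>1/2\<close> and argument \<open>2 * z\<close> gives
  the case \<open>0 \<le> z\<close>; both sides are even in \<open>z\<close>.\<close>

lemma cosh_le_exp_half_square: "(exp z + exp (- z)) / 2 \<le> exp (z\<^sup>2 / 2)" for z :: real
proof -
  have nonneg: "(exp z + exp (- z)) / 2 \<le> exp (z\<^sup>2 / 2)" if "0 \<le> z" for z :: real
  proof -
    have "- (2 * z) * (1/2) + ln (1 + (1/2) * (exp (2 * z) - 1)) \<le> (2 * z)\<^sup>2 / 8"
      using Hoeffdings_lemma_aux[of "2 * z" "1/2"] that by simp
    then have "ln ((1 + exp (2 * z)) / 2) \<le> z + z\<^sup>2 / 2"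
      by (simp add: field_simps power2_eq_square)
    then have "(1 + exp (2 * z)) / 2 \<le> exp (z + z\<^sup>2 / 2)"
      by (smt (verit) exp_gt_zero exp_le_cancel_iff exp_ln half_gt_zero)
    then have "exp (- z) * ((1 + exp (2 * z)) / 2) \<le> exp (- z) * exp (z + z\<^sup>2 / 2)"
      by simp
    moreover have "exp (- z) * exp (2 * z) = exp z"
      by (simp flip: exp_add)
    moreover have "exp (- z) * exp (z + z\<^sup>2 / 2) = exp (z\<^sup>2 / 2)"
      by (simp flip: exp_add)
    ultimately show ?thesis
      by (simp add: algebra_simps)
  qed
  show ?thesis
    using nonneg[of z] nonneg[of "- z"] by (cases "0 \<le> z") (simp_all add: add.commute)
qed

section \<open>Averages over the subsets of a finite set\<close>

definition pavg :: "'a set \<Rightarrow> ('a set \<Rightarrow> real) \<Rightarrow> real" where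
  "pavg S F = (\<Sum>X\<in>Pow S. F X) / 2 ^ card S"

lemma pavg_mono: "pavg S F \<le> pavg S G" if "\<And>X. X \<subseteq> S \<Longrightarrow> F X \<le> G X"
  unfolding pavg_def by (intro divide_right_mono sum_mono) (use that in auto)

lemma pavg_cong: "pavg S F = pavg S G" if "\<And>X. X \<subseteq> S \<Longrightarrow> F X = G X"
  unfolding pavg_def by (intro arg_cong2[where f = "(/)"] sum.cong) (use that in auto)

lemma pavg_const: "finite S \<Longrightarrow> pavg S (\<lambda>_. c) = c"
  by (simp add: pavg_def card_Pow)

lemma pavg_nonneg: "0 \<le> pavg S F" if "\<And>X. X \<subseteq> S \<Longrightarrow> 0 \<le> F X"
  unfolding pavg_def by (intro divide_nonneg_nonneg sum_nonneg) (use that in auto)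

lemma pavg_add: "pavg S (\<lambda>X. F X + G X) = pavg S F + pavg S G"
  by (simp add: pavg_def sum.distrib add_divide_distrib)

lemma pavg_diff: "pavg S (\<lambda>X. F X - G X) = pavg S F - pavg S G"
  by (simp add: pavg_def sum_subtractf diff_divide_distrib)

lemma pavg_cmult: "pavg S (\<lambda>X. c * F X) = c * pavg S F"
  by (simp add: pavg_def sum_distrib_left)

lemma pavg_cmult_right: "pavg S (\<lambda>X. F X * c) = pavg S F * c"
  by (simp add: pavg_def sum_distrib_right)

lemma pavg_sum: "pavg S (\<lambda>X. \<Sum>i\<in>B. F i X) = (\<Sum>i\<in>B. pavg S (F i))"
  unfolding pavg_def sum_divide_distrib [symmetric] by (subst sum.swap) simp

lemma pavg_insert:
  assumes "finite S" "i \<notin> S"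
  shows "pavg (insert i S) F = (pavg S F + pavg S (\<lambda>X. F (insert i X))) / 2"
proof -
  have "(\<Sum>X\<in>Pow (insert i S). F X) = (\<Sum>X\<in>Pow S. F X) + (\<Sum>X\<in>insert i ` Pow S. F X)"
    unfolding Pow_insert by (rule sum.union_disjoint) (use assms in auto)
  also have "(\<Sum>X\<in>insert i ` Pow S. F X) = (\<Sum>X\<in>Pow S. F (insert i X))"
    by (subst sum.reindex) (use assms in \<open>auto simp: inj_on_def\<close>)
  finally show ?thesis
    using assms by (simp add: pavg_def field_simps)
qed

text \<open>Subsets are the points of the cube and \<open>chi i\<close> is its \<open>i\<close>-th
  sign coordinate, so the average of \<open>chi i X * F X\<close> is a level-one Fourier coefficient
  of \<open>F\<close>.\<close>

definition chi :: "'a \<Rightarrow> 'a set \<Rightarrow> real" where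
  "chi i X = (if i \<in> X then 1 else - 1)"

text \<open>Coordinate \<open>i\<close> splits the cube into two faces. The coefficient is half the
  difference of the face averages, just as the mean in \<open>pavg_insert\<close> is half their
  sum.\<close>

lemma pavg_chi:
  assumes "finite S" "i \<notin> S"
  shows "pavg (insert i S) (\<lambda>X. chi i X * F X) = (pavg S (\<lambda>X. F (insert i X)) - pavg S F) / 2"
proof -
  have "pavg S (\<lambda>X. chi i X * F X) = pavg S (\<lambda>X. (- 1) * F X)"
    by (rule pavg_cong) (use assms in \<open>auto simp: chi_def\<close>)
  also have "\<dots> = - pavg S F"
    by (subst pavg_cmult) simp
  finally have "pavg S (\<lambda>X. chi i X * F X) = - pavg S F" .
  moreover have "pavg S (\<lambda>X. chi i (insert i X) * F (insert i X)) = pavg S (\<lambda>X. F (insert i X))"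
    by (rule pavg_cong) (simp add: chi_def)
  ultimately show ?thesis
    by (simp add: pavg_insert[OF assms])
qed

text \<open>Uniform signs are independent, so the average factors over the coordinates into
  hyperbolic cosines of \<open>c i\<close>, each with the sub-Gaussian bound.\<close>

lemma pavg_exp_chi_le:
  assumes "finite S"
  shows "pavg S (\<lambda>X. exp (\<Sum>i\<in>S. c i * chi i X)) \<le> exp ((\<Sum>i\<in>S. (c i)\<^sup>2) / 2)"
proof -
  have split: "exp (\<Sum>i\<in>S. c i * chi i X) = (\<Prod>i\<in>X. exp (c i)) * (\<Prod>i\<in>S - X. exp (- c i))"
    if "X \<subseteq> S" for X
  proof -
    have "(\<Sum>i\<in>S. c i * chi i X) = (\<Sum>i\<in>S - X. c i * chi i X) + (\<Sum>i\<in>X. c i * chi i X)"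
      using assms that by (rule sum.subset_diff[rotated])
    also have "\<dots> = (\<Sum>i\<in>S - X. - c i) + (\<Sum>i\<in>X. c i)"
      by (intro arg_cong2[where f = "(+)"] sum.cong) (auto simp: chi_def)
    finally show ?thesis
      using assms that by (simp add: exp_add exp_sum finite_subset flip: sum_negf)
  qed
  have "pavg S (\<lambda>X. exp (\<Sum>i\<in>S. c i * chi i X))
      = (\<Sum>X\<in>Pow S. (\<Prod>i\<in>X. exp (c i)) * (\<Prod>i\<in>S - X. exp (- c i))) / 2 ^ card S"
    unfolding pavg_def by (intro arg_cong2[where f = "(/)"] sum.cong) (auto simp: split)
  also have "\<dots> = (\<Prod>i\<in>S. exp (c i) + exp (- c i)) / 2 ^ card S"
    by (simp add: prod_add assms)
  also have "\<dots> = (\<Prod>i\<in>S. (exp (c i) + exp (- c i)) / 2)"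
    by (simp add: prod_dividef)
  also have "\<dots> \<le> (\<Prod>i\<in>S. exp ((c i)\<^sup>2 / 2))"
    by (intro prod_mono conjI cosh_le_exp_half_square) (simp add: add_nonneg_nonneg)
  also have "\<dots> = exp ((\<Sum>i\<in>S. (c i)\<^sup>2) / 2)"
    using assms by (simp add: exp_sum sum_divide_distrib)
  finally show ?thesis .
qed

text \<open>With \<open>m\<close> the average of \<open>F\<close> and \<open>L = \<Sum>i. c i / m * chi i\<close>, the average of \<open>F * exp L\<close> is bounded
  below by the tangent of \<open>exp\<close> at \<open>W / m\<^sup>2\<close> and above by the sub-Gaussian bound for \<open>exp L\<close>.\<close>

lemma level_one_inequality:
  assumes fin: "finite S" and F: "\<And>X. X \<subseteq> S \<Longrightarrow> 0 \<le> F X" "\<And>X. X \<subseteq> S \<Longrightarrow> F X \<le> 1"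
    and pos: "0 < pavg S F"
  shows "(\<Sum>i\<in>S. (pavg S (\<lambda>X. chi i X * F X))\<^sup>2) \<le> 2 * (pavg S F)\<^sup>2 * ln (1 / pavg S F)"
proof -
  define m where "m = pavg S F"
  define c where "c i = pavg S (\<lambda>X. chi i X * F X)" for i
  define W where "W = (\<Sum>i\<in>S. (c i)\<^sup>2)"
  define L where "L X = (\<Sum>i\<in>S. (c i / m) * chi i X)" for X
  define z where "z = W / m\<^sup>2"
  have m: "0 < m"
    using pos by (simp add: m_def)
  have "pavg S (\<lambda>X. L X * F X) = pavg S (\<lambda>X. \<Sum>i\<in>S. (c i / m) * (chi i X * F X))"
    by (simp add: L_def sum_distrib_right mult.assoc)
  also have "\<dots> = (\<Sum>i\<in>S. (c i / m) * c i)"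
    by (simp only: pavg_sum pavg_cmult c_def)
  also have "\<dots> = W / m"
    by (simp add: W_def sum_divide_distrib power2_eq_square)
  finally have LF: "pavg S (\<lambda>X. L X * F X) = W / m" .
  \<comment> \<open>\<open>z\<close> is the mean of \<open>L\<close> under the density
    \<open>F / m\<close>, so the linear term of the tangent averages to 0 and only its value
    \<open>exp z\<close> remains.\<close>
  have "exp z * m = exp z * ((1 - z) * m + W / m)"
    using m by (simp add: z_def field_simps power2_eq_square)
  also have "\<dots> = pavg S (\<lambda>X. exp z * ((1 - z) * F X + L X * F X))"
    by (simp only: pavg_cmult pavg_add LF flip: m_def)
  also have "\<dots> \<le> pavg S (\<lambda>X. exp (L X))"
  proof (rule pavg_mono)
    fix X assume X: "X \<subseteq> S"
    have "exp z * (1 + (L X - z)) \<le> exp z * exp (L X - z)"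
      by (intro mult_left_mono exp_ge_add_one_self) simp
    then have "exp z * (1 + (L X - z)) \<le> exp (L X)"
      by (simp flip: exp_add)
    then have "exp z * (1 + (L X - z)) * F X \<le> exp (L X) * F X"
      by (rule mult_right_mono) (rule F(1)[OF X])
    also have "\<dots> \<le> exp (L X)"
      using F(2)[OF X] by (simp add: mult_le_cancel_left1)
    finally show "exp z * ((1 - z) * F X + L X * F X) \<le> exp (L X)"
      by (simp add: algebra_simps)
  qed
  also have "\<dots> \<le> exp ((\<Sum>i\<in>S. (c i / m)\<^sup>2) / 2)"
    unfolding L_def by (rule pavg_exp_chi_le[OF fin])
  also have "(\<Sum>i\<in>S. (c i / m)\<^sup>2) = z"
    by (simp add: z_def W_def power_divide sum_divide_distrib)
  finally have "exp z * m \<le> exp (z / 2)" .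
  then have "ln (exp z * m) \<le> ln (exp (z / 2))"
    using m by (subst ln_le_cancel_iff) auto
  then have "z + ln m \<le> z / 2"
    using m by (simp add: ln_mult)
  then have "W / m\<^sup>2 \<le> 2 * ln (1 / m)"
    using m by (simp add: z_def ln_div)
  then show ?thesis
    using m by (simp add: W_def c_def m_def field_simps)
qed

section \<open>Communication complexity of disjointness\<close>

text \<open>Multiply by \<open>(sqrt a + sqrt b)\<^sup>2\<close>, which is at least
  \<open>a + b\<close>. The bound turns Hellinger terms into quotients that level-one coefficients
  control.\<close>

lemma sqrt_diff_square_le:
  assumes "0 \<le> a" "0 \<le> b"
  shows "(sqrt a - sqrt b)\<^sup>2 \<le> (a - b)\<^sup>2 / (a + b)"
proof (cases "a + b = 0")
  case True
  then have "a = 0" "b = 0"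
    using assms by auto
  then show ?thesis
    by simp
next
  case False
  then have pos: "0 < a + b"
    using assms by linarith
  have "a + b \<le> (sqrt a + sqrt b)\<^sup>2"
    using assms by (simp add: power2_sum)
  then have "(sqrt a - sqrt b)\<^sup>2 * (a + b) \<le> (sqrt a - sqrt b)\<^sup>2 * (sqrt a + sqrt b)\<^sup>2"
    by (intro mult_left_mono) simp_all
  also have "\<dots> = ((sqrt a + sqrt b) * (sqrt a - sqrt b))\<^sup>2"
    by (simp add: power_mult_distrib)
  also have "(sqrt a + sqrt b) * (sqrt a - sqrt b) = a - b"
    using assms by (simp add: algebra_simps)
  finally show ?thesis
    using pos by (simp add: field_simps)
qed

text \<open>The difference factors as \<open>s * t\<close>, and the arithmetic-geometric mean
  inequality is weighted so that the remainder, summed over two probability distributions, is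
  \<open>1/6\<close>: half of the advantage \<open>1/3\<close> that is available later.\<close>

lemma diff_le_hellinger:
  assumes "0 \<le> p" "0 \<le> (q :: real)"
  shows "\<bar>p - q\<bar> \<le> 6 * (sqrt p - sqrt q)\<^sup>2 + (p + q) / 12"
proof -
  define s t where "s = \<bar>sqrt p - sqrt q\<bar>" and "t = sqrt p + sqrt q"
  have t0: "0 \<le> t"
    using assms by (simp add: t_def)
  have "p - q = (sqrt p - sqrt q) * (sqrt p + sqrt q)"
    using assms by (simp add: algebra_simps)
  then have "\<bar>p - q\<bar> = s * t"
    using t0 by (simp add: s_def t_def abs_mult)
  moreover have "t\<^sup>2 \<le> 2 * (p + q)"
  proof -
    have "t\<^sup>2 + (sqrt p - sqrt q)\<^sup>2 = 2 * (p + q)"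
      using assms by (simp add: t_def power2_sum power2_diff)
    then show ?thesis
      using zero_le_power2[of "sqrt p - sqrt q"] by linarith
  qed
  moreover have "s * t \<le> 6 * s\<^sup>2 + t\<^sup>2 / 24"
    using zero_le_power2[of "12 * s - t"] by (simp add: power2_diff power_mult_distrib)
  moreover have "s\<^sup>2 = (sqrt p - sqrt q)\<^sup>2"
    by (simp add: s_def)
  ultimately show ?thesis
    by linarith
qed

text \<open>A rectangular transcript has probabilities of product form \<open>a b\<close>, so the Hellinger affinity of
  the inputs 00 and 11 equals that of 10 and 01; the latter are compared through 00.\<close>

lemma cut_and_paste:
  fixes a0 a1 b0 b1 :: "'p \<Rightarrow> real"
  assumes fin: "finite P" and A: "Acc \<subseteq> P"
    and nn: "\<And>p. 0 \<le> a0 p" "\<And>p. 0 \<le> a1 p" "\<And>p. 0 \<le> b0 p" "\<And>p. 0 \<le> b1 p"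
    and one: "(\<Sum>p\<in>P. a0 p * b0 p) = 1" "(\<Sum>p\<in>P. a1 p * b1 p) = 1"
      "(\<Sum>p\<in>P. a1 p * b0 p) = 1" "(\<Sum>p\<in>P. a0 p * b1 p) = 1"
  shows "(\<Sum>p\<in>Acc. a1 p * b1 p - a0 p * b0 p) \<le>
      12 * (\<Sum>p\<in>P. b0 p * ((a1 p - a0 p)\<^sup>2 / (a1 p + a0 p)))
    + 12 * (\<Sum>p\<in>P. a0 p * ((b1 p - b0 p)\<^sup>2 / (b1 p + b0 p))) + 1 / 6"
proof -
  have hell: "(\<Sum>p\<in>P. (sqrt (u p) - sqrt (v p))\<^sup>2)
      = (\<Sum>p\<in>P. u p) + (\<Sum>p\<in>P. v p) - 2 * (\<Sum>p\<in>P. sqrt (u p * v p))"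
    if "\<And>p. 0 \<le> u p" "\<And>p. 0 \<le> v p" for u v :: "'p \<Rightarrow> real"
    using that by (simp add: power2_diff sum.distrib sum_subtractf sum_distrib_left real_sqrt_mult mult.assoc)
  have "(\<Sum>p\<in>Acc. a1 p * b1 p - a0 p * b0 p) \<le> (\<Sum>p\<in>Acc. \<bar>a1 p * b1 p - a0 p * b0 p\<bar>)"
    by (intro sum_mono) auto
  also have "\<dots> \<le> (\<Sum>p\<in>P. \<bar>a1 p * b1 p - a0 p * b0 p\<bar>)"
    by (intro sum_mono2 fin A) auto
  also have "\<dots> \<le> (\<Sum>p\<in>P. 6 * (sqrt (a1 p * b1 p) - sqrt (a0 p * b0 p))\<^sup>2 + (a1 p * b1 p + a0 p * b0 p) / 12)"
    by (intro sum_mono diff_le_hellinger mult_nonneg_nonneg nn)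
  also have "\<dots> = 6 * (\<Sum>p\<in>P. (sqrt (a1 p * b1 p) - sqrt (a0 p * b0 p))\<^sup>2)
      + ((\<Sum>p\<in>P. a1 p * b1 p) + (\<Sum>p\<in>P. a0 p * b0 p)) / 12"
    by (simp only: sum.distrib sum_distrib_left sum_divide_distrib add_divide_distrib)
  also have "\<dots> = 6 * (\<Sum>p\<in>P. (sqrt (a1 p * b1 p) - sqrt (a0 p * b0 p))\<^sup>2) + 1 / 6"
    by (simp add: one)
  \<comment> \<open>By \<open>hell\<close> and \<open>one\<close> both sides are 2 minus twice the
    same affinity, in which all four factors appear under the root.\<close>
  also have "(\<Sum>p\<in>P. (sqrt (a1 p * b1 p) - sqrt (a0 p * b0 p))\<^sup>2)
      = (\<Sum>p\<in>P. (sqrt (a1 p * b0 p) - sqrt (a0 p * b1 p))\<^sup>2)"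
    using nn by (simp add: hell one mult_ac)
  also have "\<dots> \<le> (\<Sum>p\<in>P. 2 * (b0 p * ((a1 p - a0 p)\<^sup>2 / (a1 p + a0 p)))
      + 2 * (a0 p * ((b1 p - b0 p)\<^sup>2 / (b1 p + b0 p))))"
  proof (rule sum_mono)
    fix p
    have tri: "(x - z)\<^sup>2 \<le> 2 * (x - y)\<^sup>2 + 2 * (z - y)\<^sup>2" for x y z :: real
      using zero_le_power2[of "x + z - 2 * y"] by (simp add: power2_eq_square algebra_simps)
    have "(sqrt (a1 p * b0 p) - sqrt (a0 p * b1 p))\<^sup>2 \<le>
        2 * (sqrt (a1 p * b0 p) - sqrt (a0 p * b0 p))\<^sup>2 + 2 * (sqrt (a0 p * b1 p) - sqrt (a0 p * b0 p))\<^sup>2"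
      by (rule tri)
    also have "sqrt (a1 p * b0 p) - sqrt (a0 p * b0 p) = sqrt (b0 p) * (sqrt (a1 p) - sqrt (a0 p))"
      by (simp add: real_sqrt_mult algebra_simps)
    also have "sqrt (a0 p * b1 p) - sqrt (a0 p * b0 p) = sqrt (a0 p) * (sqrt (b1 p) - sqrt (b0 p))"
      by (simp add: real_sqrt_mult algebra_simps)
    also have "2 * (sqrt (b0 p) * (sqrt (a1 p) - sqrt (a0 p)))\<^sup>2 + 2 * (sqrt (a0 p) * (sqrt (b1 p) - sqrt (b0 p)))\<^sup>2
        = 2 * (b0 p * (sqrt (a1 p) - sqrt (a0 p))\<^sup>2) + 2 * (a0 p * (sqrt (b1 p) - sqrt (b0 p))\<^sup>2)"
      using nn by (simp add: power_mult_distrib)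
    also have "\<dots> \<le> 2 * (b0 p * ((a1 p - a0 p)\<^sup>2 / (a1 p + a0 p)))
      + 2 * (a0 p * ((b1 p - b0 p)\<^sup>2 / (b1 p + b0 p)))"
      by (intro add_mono mult_left_mono sqrt_diff_square_le nn) auto
    finally show "(sqrt (a1 p * b0 p) - sqrt (a0 p * b1 p))\<^sup>2 \<le> 2 * (b0 p * ((a1 p - a0 p)\<^sup>2 / (a1 p + a0 p)))
      + 2 * (a0 p * ((b1 p - b0 p)\<^sup>2 / (b1 p + b0 p)))" .
  qed
  finally have "(\<Sum>p\<in>Acc. a1 p * b1 p - a0 p * b0 p) \<le>
      6 * (2 * (\<Sum>p\<in>P. b0 p * ((a1 p - a0 p)\<^sup>2 / (a1 p + a0 p)))
        + 2 * (\<Sum>p\<in>P. a0 p * ((b1 p - b0 p)\<^sup>2 / (b1 p + b0 p)))) + 1 / 6"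
    by (simp only: sum.distrib sum_distrib_left)
  moreover have "6 * (2 * A + 2 * B) + 1 / 6 = 12 * A + 12 * B + 1 / 6" for A B :: real
    by simp
  ultimately show ?thesis
    by (simp only:)
qed

section \<open>Influences of coordinates and the entropy of transcripts\<close>

lemma sum_Pow_remove_swap:
  assumes "finite I"
  shows "(\<Sum>i\<in>I. \<Sum>d\<in>Pow (I - {i}). G i d) = (\<Sum>D\<in>Pow I. \<Sum>i\<in>I - D. G i D)"
proof -
  have "(\<Sum>i\<in>I. \<Sum>d\<in>Pow (I - {i}). G i d) = (\<Sum>(i, d)\<in>(SIGMA i:I. Pow (I - {i})). G i d)"
    by (rule sum.Sigma) (use assms in auto)
  also have "\<dots> = (\<Sum>(D, i)\<in>(SIGMA D:Pow I. I - D). G i D)"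
    by (rule sum.reindex_bij_witness[where i = "\<lambda>(D, i). (i, D)" and j = "\<lambda>(i, d). (d, i)"]) auto
  also have "\<dots> = (\<Sum>D\<in>Pow I. \<Sum>i\<in>I - D. G i D)"
    by (rule sum.Sigma[symmetric]) (use assms in auto)
  finally show ?thesis .
qed

lemma sum_Pow_complement: "(\<Sum>D\<in>Pow I. G (I - D)) = (\<Sum>D\<in>Pow I. G D)"
  by (rule sum.reindex_bij_witness[where i = "\<lambda>D. I - D" and j = "\<lambda>D. I - D"]) (auto simp: double_diff)

text \<open>After exchanging the sums, \<open>D\<close> is fixed and \<open>i\<close> runs through
  \<open>I - D\<close>. Difference and sum of the face averages are twice the level-one coefficient
  and twice the mean \<open>m\<close>, so each quotient is \<open>2 * (c i)\<^sup>2 / m\<close>, and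
  the level-one inequality bounds their total by \<open>4 * m * ln (1 / m)\<close>.\<close>

lemma sum_influence_le:
  fixes f g :: "'a set \<Rightarrow> real"
  assumes fin: "finite I"
    and f: "\<And>X. 0 \<le> f X" "\<And>X. f X \<le> 1" and g: "\<And>X. 0 \<le> g X"
  shows "(\<Sum>i\<in>I. \<Sum>d\<in>Pow (I - {i}). pavg d g *
       ((pavg (I - {i} - d) (\<lambda>X. f (insert i X)) - pavg (I - {i} - d) f)\<^sup>2 /
        (pavg (I - {i} - d) (\<lambda>X. f (insert i X)) + pavg (I - {i} - d) f)))
    \<le> 4 * (\<Sum>D\<in>Pow I. pavg (I - D) f * pavg D g * ln (1 / pavg (I - D) f))"
proof -
  have "(\<Sum>i\<in>I - D. pavg D g *
       ((pavg (I - {i} - D) (\<lambda>X. f (insert i X)) - pavg (I - {i} - D) f)\<^sup>2 /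
        (pavg (I - {i} - D) (\<lambda>X. f (insert i X)) + pavg (I - {i} - D) f)))
      \<le> 4 * (pavg (I - D) f * pavg D g * ln (1 / pavg (I - D) f))" (is "?L \<le> ?R") for D
  proof -
    define m where "m = pavg (I - D) f"
    define c where "c i = pavg (I - D) (\<lambda>X. chi i X * f X)" for i
    have m0: "0 \<le> m"
      unfolding m_def by (intro pavg_nonneg f)
    have "?L = (\<Sum>i\<in>I - D. pavg D g * ((2 * c i)\<^sup>2 / (2 * m)))"
    proof (rule sum.cong[OF refl])
      fix i assume i: "i \<in> I - D"
      then have I: "I - D = insert i (I - {i} - D)"
        by auto
      have "2 * c i = pavg (I - {i} - D) (\<lambda>X. f (insert i X)) - pavg (I - {i} - D) f"
        unfolding c_def by (subst I, subst pavg_chi) (use fin in auto)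
      moreover have "2 * m = pavg (I - {i} - D) (\<lambda>X. f (insert i X)) + pavg (I - {i} - D) f"
        unfolding m_def by (subst I, subst pavg_insert) (use fin in auto)
      ultimately show "pavg D g *
       ((pavg (I - {i} - D) (\<lambda>X. f (insert i X)) - pavg (I - {i} - D) f)\<^sup>2 /
        (pavg (I - {i} - D) (\<lambda>X. f (insert i X)) + pavg (I - {i} - D) f)) = pavg D g * ((2 * c i)\<^sup>2 / (2 * m))"
        by (simp only:)
    qed
    also have "\<dots> = pavg D g * (2 / m) * (\<Sum>i\<in>I - D. (c i)\<^sup>2)"
      by (simp add: sum_distrib_left power_mult_distrib field_simps)
    also have "\<dots> \<le> ?R"
    \<comment> \<open>For \<open>m = 0\<close> division by zero makes both sides 0.\<close>
    proof (cases "m = 0")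
      case True
      then show ?thesis
        by (simp flip: m_def)
    next
      case False
      then have m: "0 < m"
        using m0 by simp
      then have "(\<Sum>i\<in>I - D. (c i)\<^sup>2) \<le> 2 * m\<^sup>2 * ln (1 / m)"
        unfolding c_def m_def by (intro level_one_inequality) (use fin f in auto)
      then have "pavg D g * (2 / m) * (\<Sum>i\<in>I - D. (c i)\<^sup>2) \<le> pavg D g * (2 / m) * (2 * m\<^sup>2 * ln (1 / m))"
        using m by (intro mult_left_mono mult_nonneg_nonneg pavg_nonneg g) auto
      also have "\<dots> = 4 * (m * pavg D g * ln (1 / m))"
        using m by (simp add: power2_eq_square)
      finally show ?thesis
        by (simp add: m_def)
    qed
    finally show ?thesis .
  qed
  then show ?thesis
    unfolding sum_Pow_remove_swap[OF fin] sum_distrib_left by (rule sum_mono)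
qed

text \<open>Gibbs' inequality against the uniform distribution, from \<open>ln t \<le> t - 1\<close>
  with \<open>t = 1 / (p x * card P)\<close>.\<close>

lemma entropy_le_ln_card:
  fixes p :: "'p \<Rightarrow> real"
  assumes fin: "finite P" and nn: "\<And>x. x \<in> P \<Longrightarrow> 0 \<le> p x" and one: "(\<Sum>x\<in>P. p x) = 1"
  shows "(\<Sum>x\<in>P. p x * ln (1 / p x)) \<le> ln (card P)"
proof -
  have "P \<noteq> {}"
    using one by auto
  then have card: "0 < real (card P)"
    using fin by (simp add: card_gt_0_iff)
  have "(\<Sum>x\<in>P. p x * ln (1 / p x)) - ln (card P) = (\<Sum>x\<in>P. p x * ln (1 / p x) - p x * ln (card P))"
    using one by (simp add: sum_subtractf flip: sum_distrib_right)
  also have "\<dots> \<le> (\<Sum>x\<in>P. 1 / card P - p x)"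
  proof (rule sum_mono)
    fix x assume "x \<in> P"
    show "p x * ln (1 / p x) - p x * ln (card P) \<le> 1 / card P - p x"
    proof (cases "p x = 0")
      case False
      then have px: "0 < p x"
        using nn[OF \<open>x \<in> P\<close>] by simp
      have "p x * ln (1 / p x) - p x * ln (card P) = p x * ln (1 / (p x * card P))"
        using px card by (simp add: ln_div ln_mult algebra_simps)
      also have "\<dots> \<le> p x * (1 / (p x * card P) - 1)"
        using px card by (intro mult_left_mono ln_le_minus_one) auto
      also have "\<dots> = 1 / card P - p x"
        using px by (simp add: field_simps)
      finally show ?thesis .
    qed simp
  qed
  also have "\<dots> = 0"
    using card one by (simp add: sum_subtractf)
  finally show ?thesis
    by simp
qed

lemma pavg_times: "pavg S F * pavg R G = pavg S (\<lambda>X. pavg R (\<lambda>Y. F X * G Y))"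
  by (simp only: pavg_cmult pavg_cmult_right)

text \<open>The sum in the last assumption runs over the hard distribution: a coordinate \<open>i\<close>, a set \<open>d\<close> of
  coordinates owned by the second player, and uniform \<open>X \<subseteq> I - {i} - d\<close>, \<open>Y \<subseteq> d\<close>, which are disjoint
  until \<open>i\<close> is added to both. The fibres of \<open>\<tau>\<close> are combinatorial rectangles.\<close>

theorem disjointness_transcript_bound:
  fixes \<tau> :: "'a set \<Rightarrow> 'a set \<Rightarrow> 'p"
  assumes fin: "finite I" and finP: "finite P"
    and \<tau>: "\<And>x y. x \<subseteq> I \<Longrightarrow> y \<subseteq> I \<Longrightarrow> \<tau> x y \<in> P"
    and rect: "\<And>x x' y y'. x \<subseteq> I \<Longrightarrow> x' \<subseteq> I \<Longrightarrow> y \<subseteq> I \<Longrightarrow> y' \<subseteq> I \<Longrightarrow> \<tau> x y = \<tau> x' y' \<Longrightarrow> \<tau> x y' = \<tau> x y"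
    and adv: "card I * 2 ^ (card I - 1) / 3 \<le> (\<Sum>i\<in>I. \<Sum>d\<in>Pow (I - {i}).
        pavg (I - {i} - d) (\<lambda>X. pavg d (\<lambda>Y.
          of_bool (acc (\<tau> (insert i X) (insert i Y))) - of_bool (acc (\<tau> X Y)))))"
  shows "card I / 576 \<le> ln (card P)"
proof (cases "I = {}")
  case True
  have "0 < card P"
    using \<tau>[of "{}" "{}"] finP by (auto simp: card_gt_0_iff)
  then have "0 \<le> ln (real (card P))"
    by (intro ln_ge_zero) (simp add: Suc_le_eq)
  then show ?thesis
    using True by simp
next
  case False
  \<comment> \<open>\<open>f p\<close> and \<open>g p\<close> are the indicators of the two
    projections of the fibre of \<open>p\<close>; by \<open>rect\<close> the fibre is the product of
    these projections.\<close>
  define f :: "'p \<Rightarrow> 'a set \<Rightarrow> real" where "f p x = of_bool (\<exists>y\<subseteq>I. \<tau> x y = p)" for p x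
  define g :: "'p \<Rightarrow> 'a set \<Rightarrow> real" where "g p y = of_bool (\<exists>x\<subseteq>I. \<tau> x y = p)" for p y
  define Acc where "Acc = {p \<in> P. acc p}"
  have fg: "f p x * g p y = of_bool (\<tau> x y = p)" if "x \<subseteq> I" "y \<subseteq> I" for p x y
  proof -
    have "(\<exists>y\<subseteq>I. \<tau> x y = p) \<and> (\<exists>x\<subseteq>I. \<tau> x y = p) \<longleftrightarrow> \<tau> x y = p"
    proof
      assume "(\<exists>y\<subseteq>I. \<tau> x y = p) \<and> (\<exists>x\<subseteq>I. \<tau> x y = p)"
      then obtain x' y' where "x' \<subseteq> I" "y' \<subseteq> I" "\<tau> x y' = p" "\<tau> x' y = p"
        by auto
      then show "\<tau> x y = p"
        using rect[of x x' y' y] that by simp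
    qed (use that in blast)
    then show ?thesis
      unfolding f_def g_def of_bool_conj[symmetric] by simp
  qed
  have bounds: "0 \<le> f p x" "f p x \<le> 1" "0 \<le> g p x" "g p x \<le> 1" for p x
    by (auto simp: f_def g_def)
  have nn: "0 \<le> pavg S (f p)" "0 \<le> pavg S (g p)" "0 \<le> pavg S (\<lambda>X. f p (insert i X))" "0 \<le> pavg S (\<lambda>X. g p (insert i X))"
    for S p i by (auto intro!: pavg_nonneg bounds)
  have acc: "(\<Sum>p\<in>Acc. f p x * g p y) = of_bool (acc (\<tau> x y))" if "x \<subseteq> I" "y \<subseteq> I" for x y
  proof -
    have "(\<Sum>p\<in>Acc. f p x * g p y) = (\<Sum>p\<in>Acc. if \<tau> x y = p then 1 else 0)"
      by (intro sum.cong) (auto simp: fg that)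
    also have "\<dots> = of_bool (acc (\<tau> x y))"
      using finP \<tau>[OF that] by (simp add: Acc_def)
    finally show ?thesis .
  qed
  have tot: "(\<Sum>p\<in>P. f p x * g p y) = 1" if "x \<subseteq> I" "y \<subseteq> I" for x y
  proof -
    have "(\<Sum>p\<in>P. f p x * g p y) = (\<Sum>p\<in>P. if \<tau> x y = p then 1 else 0)"
      by (intro sum.cong) (auto simp: fg that)
    then show ?thesis
      using finP \<tau>[OF that] by simp
  qed
  have one: "(\<Sum>p\<in>P. pavg S (\<lambda>X. f p (s X)) * pavg R (\<lambda>Y. g p (r Y))) = 1"
    if "finite S" "finite R" "\<And>X. X \<subseteq> S \<Longrightarrow> s X \<subseteq> I" "\<And>Y. Y \<subseteq> R \<Longrightarrow> r Y \<subseteq> I" for S R s r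
  proof -
    have "(\<Sum>p\<in>P. pavg S (\<lambda>X. f p (s X)) * pavg R (\<lambda>Y. g p (r Y)))
        = pavg S (\<lambda>X. pavg R (\<lambda>Y. \<Sum>p\<in>P. f p (s X) * g p (r Y)))"
      by (simp only: pavg_times pavg_sum)
    also have "\<dots> = pavg S (\<lambda>X. pavg R (\<lambda>Y. 1))"
      by (intro pavg_cong tot that)
    finally show ?thesis
      by (simp add: pavg_const that)
  qed
  let ?T1 = "\<lambda>p i d. pavg d (g p) *
       ((pavg (I - {i} - d) (\<lambda>X. f p (insert i X)) - pavg (I - {i} - d) (f p))\<^sup>2 /
        (pavg (I - {i} - d) (\<lambda>X. f p (insert i X)) + pavg (I - {i} - d) (f p)))"
  let ?T2 = "\<lambda>p i d. pavg (I - {i} - d) (f p) *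
       ((pavg d (\<lambda>X. g p (insert i X)) - pavg d (g p))\<^sup>2 /
        (pavg d (\<lambda>X. g p (insert i X)) + pavg d (g p)))"
  have step: "pavg (I - {i} - d) (\<lambda>X. pavg d (\<lambda>Y.
          of_bool (acc (\<tau> (insert i X) (insert i Y))) - of_bool (acc (\<tau> X Y))))
      \<le> 12 * (\<Sum>p\<in>P. ?T1 p i d) + 12 * (\<Sum>p\<in>P. ?T2 p i d) + 1 / 6"
    if i: "i \<in> I" and d: "d \<in> Pow (I - {i})" for i d
  proof -
    have fins: "finite (I - {i} - d)" "finite d"
      using fin d by (auto intro: finite_subset)
    have sub: "\<And>X. X \<subseteq> I - {i} - d \<Longrightarrow> X \<subseteq> I" "\<And>X. X \<subseteq> I - {i} - d \<Longrightarrow> insert i X \<subseteq> I"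
      "\<And>Y. Y \<subseteq> d \<Longrightarrow> Y \<subseteq> I" "\<And>Y. Y \<subseteq> d \<Longrightarrow> insert i Y \<subseteq> I"
      using i d by auto
    have ones:
      "(\<Sum>p\<in>P. pavg (I - {i} - d) (f p) * pavg d (g p)) = 1"
      "(\<Sum>p\<in>P. pavg (I - {i} - d) (\<lambda>X. f p (insert i X)) * pavg d (\<lambda>Y. g p (insert i Y))) = 1"
      "(\<Sum>p\<in>P. pavg (I - {i} - d) (\<lambda>X. f p (insert i X)) * pavg d (g p)) = 1"
      "(\<Sum>p\<in>P. pavg (I - {i} - d) (f p) * pavg d (\<lambda>Y. g p (insert i Y))) = 1"
      using one[OF fins sub(1,3)] one[OF fins sub(2,4)] one[OF fins sub(2,3)] one[OF fins sub(1,4)]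
      by simp_all
    have "pavg (I - {i} - d) (\<lambda>X. pavg d (\<lambda>Y.
          of_bool (acc (\<tau> (insert i X) (insert i Y))) - of_bool (acc (\<tau> X Y))))
       = pavg (I - {i} - d) (\<lambda>X. pavg d (\<lambda>Y.
          (\<Sum>p\<in>Acc. f p (insert i X) * g p (insert i Y)) - (\<Sum>p\<in>Acc. f p X * g p Y)))"
      using i d by (intro pavg_cong) (subst acc acc, auto)+
    \<comment> \<open>For fixed \<open>i\<close> and \<open>d\<close>, \<open>X\<close> and
      \<open>Y\<close> are independent, so the probability of each transcript is a product, as
      \<open>cut_and_paste\<close> requires.\<close>
    also have "\<dots> = (\<Sum>p\<in>Acc. pavg (I - {i} - d) (\<lambda>X. f p (insert i X)) * pavg d (\<lambda>Y. g p (insert i Y))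
         - pavg (I - {i} - d) (f p) * pavg d (g p))"
      by (simp only: pavg_times pavg_sum pavg_diff sum_subtractf)
    also have "\<dots> \<le> 12 * (\<Sum>p\<in>P. ?T1 p i d) + 12 * (\<Sum>p\<in>P. ?T2 p i d) + 1 / 6"
      by (rule cut_and_paste)
        (use finP ones in \<open>auto simp: Acc_def intro!: nn\<close>)
    finally show ?thesis .
  qed
  have T1: "(\<Sum>i\<in>I. \<Sum>d\<in>Pow (I - {i}). ?T1 p i d)
      \<le> 4 * (\<Sum>D\<in>Pow I. pavg (I - D) (f p) * pavg D (g p) * ln (1 / pavg (I - D) (f p)))" for p
    by (rule sum_influence_le[OF fin bounds(1,2,3)])
  have T2: "(\<Sum>i\<in>I. \<Sum>d\<in>Pow (I - {i}). ?T2 p i d)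
      \<le> 4 * (\<Sum>D\<in>Pow I. pavg (I - D) (f p) * pavg D (g p) * ln (1 / pavg D (g p)))" for p
  proof -
    \<comment> \<open>The players exchange roles: replacing \<open>d\<close> by its complement in
      \<open>I - {i}\<close> makes \<open>sum_influence_le\<close> applicable with \<open>f\<close>
      and \<open>g\<close> swapped, and replacing \<open>D\<close> by \<open>I - D\<close>
      afterwards restores the original form.\<close>
    have "(\<Sum>i\<in>I. \<Sum>d\<in>Pow (I - {i}). ?T2 p i d) = (\<Sum>i\<in>I. \<Sum>d\<in>Pow (I - {i}). ?T2 p i (I - {i} - d))"
      by (intro sum.cong refl sum_Pow_complement[symmetric])
    also have "\<dots> = (\<Sum>i\<in>I. \<Sum>d\<in>Pow (I - {i}). pavg d (f p) *
       ((pavg (I - {i} - d) (\<lambda>X. g p (insert i X)) - pavg (I - {i} - d) (g p))\<^sup>2 /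
        (pavg (I - {i} - d) (\<lambda>X. g p (insert i X)) + pavg (I - {i} - d) (g p))))"
      by (intro sum.cong refl) (simp add: double_diff)
    also have "\<dots> \<le> 4 * (\<Sum>D\<in>Pow I. pavg (I - D) (g p) * pavg D (f p) * ln (1 / pavg (I - D) (g p)))"
      by (rule sum_influence_le[OF fin bounds(3,4,1)])
    also have "(\<Sum>D\<in>Pow I. pavg (I - D) (g p) * pavg D (f p) * ln (1 / pavg (I - D) (g p)))
        = (\<Sum>D\<in>Pow I. pavg (I - (I - D)) (g p) * pavg (I - D) (f p) * ln (1 / pavg (I - (I - D)) (g p)))"
      by (simp only: sum_Pow_complement[where G = "\<lambda>D. pavg (I - D) (g p) * pavg D (f p) * ln (1 / pavg (I - D) (g p))"])
    also have "\<dots> = (\<Sum>D\<in>Pow I. pavg (I - D) (f p) * pavg D (g p) * ln (1 / pavg D (g p)))"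
      by (intro sum.cong refl) (simp add: double_diff mult.commute)
    finally show ?thesis .
  qed
  \<comment> \<open>The products are the transcript probabilities for uniform
    \<open>X \<subseteq> I - D\<close> and \<open>Y \<subseteq> D\<close>; the two logarithms add up
    to the entropy of this distribution.\<close>
  have ent: "(\<Sum>p\<in>P. pavg (I - D) (f p) * pavg D (g p) * ln (1 / pavg (I - D) (f p))
        + pavg (I - D) (f p) * pavg D (g p) * ln (1 / pavg D (g p))) \<le> ln (card P)" if "D \<in> Pow I" for D
  proof -
    have "(\<Sum>p\<in>P. pavg (I - D) (f p) * pavg D (g p) * ln (1 / pavg (I - D) (f p))
        + pavg (I - D) (f p) * pavg D (g p) * ln (1 / pavg D (g p)))
      = (\<Sum>p\<in>P. pavg (I - D) (f p) * pavg D (g p) * ln (1 / (pavg (I - D) (f p) * pavg D (g p))))"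
    proof (rule sum.cong[OF refl])
      fix p
      have "0 \<le> pavg (I - D) (f p)" "0 \<le> pavg D (g p)"
        by (rule nn)+
      then show "pavg (I - D) (f p) * pavg D (g p) * ln (1 / pavg (I - D) (f p))
        + pavg (I - D) (f p) * pavg D (g p) * ln (1 / pavg D (g p))
        = pavg (I - D) (f p) * pavg D (g p) * ln (1 / (pavg (I - D) (f p) * pavg D (g p)))"
        by (cases "pavg (I - D) (f p) = 0"; cases "pavg D (g p) = 0") (auto simp: ln_div ln_mult algebra_simps)
    qed
    also have "\<dots> \<le> ln (card P)"
    proof (rule entropy_le_ln_card[OF finP])
      show "(\<Sum>p\<in>P. pavg (I - D) (f p) * pavg D (g p)) = 1"
        by (rule one) (use fin that in \<open>auto intro: finite_subset\<close>)
    qed (intro mult_nonneg_nonneg nn)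
    finally show ?thesis .
  qed
  define N where "N = card I"
  have N: "0 < N"
    using False fin by (simp add: N_def card_gt_0_iff)
  have "N * 2 ^ (N - 1) / 3 \<le> (\<Sum>i\<in>I. \<Sum>d\<in>Pow (I - {i}).
      12 * (\<Sum>p\<in>P. ?T1 p i d) + 12 * (\<Sum>p\<in>P. ?T2 p i d) + 1 / 6)"
    unfolding N_def by (rule order_trans[OF adv]) (intro sum_mono step)
  also have "\<dots> = 12 * (\<Sum>i\<in>I. \<Sum>d\<in>Pow (I - {i}). \<Sum>p\<in>P. ?T1 p i d)
      + 12 * (\<Sum>i\<in>I. \<Sum>d\<in>Pow (I - {i}). \<Sum>p\<in>P. ?T2 p i d) + (\<Sum>i\<in>I. \<Sum>d\<in>Pow (I - {i}). 1 / 6)"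
    by (simp only: sum.distrib sum_distrib_left)
  also have "(\<Sum>i\<in>I. \<Sum>d\<in>Pow (I - {i}). 1 / 6 :: real) = N * 2 ^ (N - 1) / 6"
    using fin by (simp add: N_def card_Pow)
  also have "(\<Sum>i\<in>I. \<Sum>d\<in>Pow (I - {i}). \<Sum>p\<in>P. ?T1 p i d) = (\<Sum>p\<in>P. \<Sum>i\<in>I. \<Sum>d\<in>Pow (I - {i}). ?T1 p i d)"
    by (subst sum.swap, subst (2) sum.swap, rule refl)
  also have "(\<Sum>i\<in>I. \<Sum>d\<in>Pow (I - {i}). \<Sum>p\<in>P. ?T2 p i d) = (\<Sum>p\<in>P. \<Sum>i\<in>I. \<Sum>d\<in>Pow (I - {i}). ?T2 p i d)"
    by (subst sum.swap, subst (2) sum.swap, rule refl)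
  also have "12 * (\<Sum>p\<in>P. \<Sum>i\<in>I. \<Sum>d\<in>Pow (I - {i}). ?T1 p i d) + 12 * (\<Sum>p\<in>P. \<Sum>i\<in>I. \<Sum>d\<in>Pow (I - {i}). ?T2 p i d)
      + N * 2 ^ (N - 1) / 6 \<le>
      12 * (\<Sum>p\<in>P. 4 * (\<Sum>D\<in>Pow I. pavg (I - D) (f p) * pavg D (g p) * ln (1 / pavg (I - D) (f p))))
      + 12 * (\<Sum>p\<in>P. 4 * (\<Sum>D\<in>Pow I. pavg (I - D) (f p) * pavg D (g p) * ln (1 / pavg D (g p))))
      + N * 2 ^ (N - 1) / 6"
    by (intro add_mono mult_left_mono sum_mono T1 T2) auto
  also have "\<dots> = 48 * (\<Sum>p\<in>P. \<Sum>D\<in>Pow I. pavg (I - D) (f p) * pavg D (g p) * ln (1 / pavg (I - D) (f p))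
        + pavg (I - D) (f p) * pavg D (g p) * ln (1 / pavg D (g p))) + N * 2 ^ (N - 1) / 6"
    by (simp only: sum.distrib sum_distrib_left[symmetric]) simp
  also have "\<dots> = 48 * (\<Sum>D\<in>Pow I. \<Sum>p\<in>P. pavg (I - D) (f p) * pavg D (g p) * ln (1 / pavg (I - D) (f p))
        + pavg (I - D) (f p) * pavg D (g p) * ln (1 / pavg D (g p))) + N * 2 ^ (N - 1) / 6"
    by (subst sum.swap) (rule refl)
  also have "\<dots> \<le> 48 * (\<Sum>D\<in>Pow I. ln (card P)) + N * 2 ^ (N - 1) / 6"
    by (intro add_mono mult_left_mono sum_mono ent) auto
  also have "(\<Sum>D\<in>Pow I. ln (card P)) = 2 ^ N * ln (card P)"
    using fin by (simp add: N_def card_Pow)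
  also have "(2 :: real) ^ N = 2 * 2 ^ (N - 1)"
    using N by (cases N) auto
  \<comment> \<open>There are \<open>N * 2 ^ (N - 1)\<close> pairs \<open>(i, d)\<close>. The loss
    \<open>1/6\<close> on each takes half of the advantage \<open>1/3\<close>, which leaves
    \<open>N / 6 \<le> 96 * ln (card P)\<close>.\<close>
  finally have "2 ^ (N - 1) * (N / 6) \<le> 2 ^ (N - 1) * (96 * ln (card P))"
    by (simp add: field_simps)
  then show ?thesis
    by (simp add: N_def field_simps)
qed

section \<open>Global transcripts\<close>

text \<open>Messages that are too long or addressed outside \<open>{1..n}\<close> are never
  delivered. Without them only finitely many values are possible, and these still determine what
  every node receives.\<close>

definition sent ::
  "('s, 'm, 'r, 'z) hybrid_alg_scheme \<Rightarrow> real \<Rightarrow> nat \<Rightarrow> 's \<Rightarrow> (nat \<times> bool list) list" where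
  "sent A C n s = filter (\<lambda>(x, b). x \<in> {1..n} \<and> length b \<le> cap C n) (take (cap C n) (h_gsend A s))"

definition transcript ::
  "('s, 'm, 'r, 'z) hybrid_alg_scheme \<Rightarrow> real \<Rightarrow> nat \<Rightarrow> (nat \<Rightarrow> nat \<Rightarrow> nat) \<Rightarrow> (nat \<Rightarrow> 'r)
    \<Rightarrow> nat \<Rightarrow> (nat \<times> bool list) list list list" where
  "transcript A C n w \<rho> T = map (\<lambda>t. map (\<lambda>v. sent A C n (run A C n w \<rho> t v)) [1..<Suc n]) [0..<T]"

definition transcripts :: "real \<Rightarrow> nat \<Rightarrow> nat \<Rightarrow> (nat \<times> bool list) list list list set" where
  "transcripts C n T = {xs. set xs \<subseteq> {ys. set ys \<subseteq>
      {ms. set ms \<subseteq> {1..n} \<times> {b. set b \<subseteq> UNIV \<and> length b \<le> cap C n} \<and> length ms \<le> cap C n} \<and> length ys = n} \<and> length xs = T}"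

lemma transcript_in_transcripts: "transcript A C n w \<rho> T \<in> transcripts C n T"
proof -
  define Ms where "Ms = {ms. set ms \<subseteq> {1..n} \<times> {b :: bool list. set b \<subseteq> UNIV \<and> length b \<le> cap C n}
      \<and> length ms \<le> cap C n}"
  have "length (sent A C n s) \<le> cap C n" for s
    unfolding sent_def by (rule order_trans[OF length_filter_le]) simp
  then have "sent A C n s \<in> Ms" for s
    by (auto simp: Ms_def) (auto simp: sent_def)
  then show ?thesis
    unfolding transcripts_def transcript_def Ms_def[symmetric] by (auto simp del: upt_Suc)
qed

lemma finite_transcripts: "finite (transcripts C n T)"
  unfolding transcripts_def
  by (intro finite_lists_length_eq finite_lists_length_le finite_SigmaI) auto

text \<open>A geometric sum with ratio at least 2 is at most the next power.\<close>

lemma card_lists_length_le_power: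
  assumes "finite A" "2 \<le> card A"
  shows "card {xs. set xs \<subseteq> A \<and> length xs \<le> c} \<le> card A ^ Suc c"
proof -
  have "(\<Sum>i\<le>c. card A ^ i) \<le> card A ^ Suc c"
  proof (induction c)
    case (Suc c)
    have "(\<Sum>i\<le>Suc c. card A ^ i) \<le> 2 * card A ^ Suc c"
      using Suc by simp
    also have "\<dots> \<le> card A * card A ^ Suc c"
      using assms(2) by (rule mult_le_mono1)
    finally show ?case
      by simp
  qed (use assms in simp)
  then show ?thesis
    by (simp add: card_lists_length_le[OF assms(1)])
qed

text \<open>Each of \<open>n\<close> nodes in each of \<open>T\<close> rounds sends a list of at
  most \<open>cap C n\<close> pairs of a target and a bit string, and there are at most
  \<open>n * 2 ^ Suc (cap C n)\<close> such pairs.\<close>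

lemma card_transcripts_le:
  assumes "2 \<le> n"
  shows "card (transcripts C n T) \<le> (n * 2 ^ Suc (cap C n)) ^ (Suc (cap C n) * n * T)"
proof -
  let ?c = "cap C n"
  define B where "B = {b :: bool list. set b \<subseteq> UNIV \<and> length b \<le> ?c}"
  have B: "finite B"
    unfolding B_def by (rule finite_lists_length_le) simp
  have B2: "card B \<le> 2 ^ Suc ?c"
    unfolding B_def using card_lists_length_le_power[of "UNIV :: bool set" ?c] by simp
  have "[] \<in> B"
    by (simp add: B_def)
  then have B1: "1 \<le> card B"
    using B by (simp add: Suc_le_eq card_gt_0_iff) blast
  define E where "E = {1..n} \<times> B"
  have E: "finite E" "card E = n * card B"
    using B by (simp_all add: E_def)
  have "2 \<le> card E"
    unfolding E(2) using mult_le_mono[OF assms B1] by simp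
  then have ms: "card {ms. set ms \<subseteq> E \<and> length ms \<le> ?c} \<le> (n * 2 ^ Suc ?c) ^ Suc ?c"
    using card_lists_length_le_power[OF E(1), of ?c] B2 unfolding E(2)
    by (meson mult_le_mono2 order_trans power_mono zero_le)
  have "card (transcripts C n T) = (card {ms. set ms \<subseteq> E \<and> length ms \<le> ?c} ^ n) ^ T"
    unfolding transcripts_def B_def[symmetric] E_def[symmetric]
    by (simp add: card_lists_length_eq finite_lists_length_eq finite_lists_length_le E(1))
  also have "\<dots> \<le> (((n * 2 ^ Suc ?c) ^ Suc ?c) ^ n) ^ T"
    using ms by (intro power_mono) auto
  finally show ?thesis
    by (simp only: power_mult[symmetric])
qed

lemma global_in_cong:
  assumes u: "u \<in> {1..n}" and eq: "\<And>v. v \<in> {1..n} \<Longrightarrow> sent A C n (cf v) = sent A C n (cf' v)"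
  shows "global_in A C n cf u = global_in A C n cf' u"
proof -
  have sub: "filter (\<lambda>(x, b). x = u \<and> length b \<le> cap C n) (take (cap C n) (h_gsend A s))
      = filter (\<lambda>(x, b). x = u) (sent A C n s)" for s
    unfolding sent_def filter_filter by (rule filter_cong) (use u in auto)
  have "map (\<lambda>v. map (\<lambda>(x, b). (v, b)) (filter (\<lambda>(x, b). x = u) (sent A C n (cf v)))) [1..<Suc n]
      = map (\<lambda>v. map (\<lambda>(x, b). (v, b)) (filter (\<lambda>(x, b). x = u) (sent A C n (cf' v)))) [1..<Suc n]"
    by (rule map_cong) (auto simp: eq)
  then show ?thesis
    unfolding global_in_def sub by (simp only:)
qed

lemma transcript_eq_iff:
  "transcript A C n w \<rho> T = transcript A C n w' \<rho> T \<longleftrightarrow>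
    (\<forall>t<T. \<forall>v\<in>{1..n}. sent A C n (run A C n w \<rho> t v) = sent A C n (run A C n w' \<rho> t v))"
proof -
  have "set [0..<T] = {..<T}" "set [1..<Suc n] = {1..n}"
    by auto
  then show ?thesis
    unfolding transcript_def map_eq_conv by (simp only: Ball_def lessThan_iff)
qed

text \<open>Locally, the two ends of the graph cannot influence each other across \<open>l\<close> layers
  in fewer than \<open>l/2\<close> rounds, so every node of the mixed graph \<open>wm\<close> behaves as in \<open>w\<close> or as in
  \<open>w'\<close>; globally, both executions send the same messages.\<close>

lemma run_mixed:
  assumes wm: "wgraph n wm"
    and left: "\<And>u. u \<in> {1..n} \<Longrightarrow> pos u < l \<Longrightarrow> wm u = w u"
    and right: "\<And>u. u \<in> {1..n} \<Longrightarrow> 0 < pos u \<Longrightarrow> wm u = w' u"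
    and layers: "\<And>u v. 0 < wm u v \<Longrightarrow> pos v \<le> Suc (pos u)"
    and eq: "transcript A C n w \<rho> T = transcript A C n w' \<rho> T"
    and T: "2 * T \<le> l" and t: "t \<le> T" and u: "u \<in> {1..n}"
  shows "(pos u + t < l \<longrightarrow> run A C n wm \<rho> t u = run A C n w \<rho> t u) \<and>
    (t < pos u \<longrightarrow> run A C n wm \<rho> t u = run A C n w' \<rho> t u)"
  using t u
proof (induction t arbitrary: u)
  case 0
  then show ?case
    using left right by simp
next
  case (Suc t)
  have t: "t < T" "t \<le> T"
    using Suc.prems by auto
  have same: "sent A C n (run A C n w \<rho> t v) = sent A C n (run A C n w' \<rho> t v)" if "v \<in> {1..n}" for v
    using eq that t unfolding transcript_eq_iff by blast
  \<comment> \<open>As \<open>2 * t < l\<close>, every node is still far enough from one of the two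
    ends, so its state is one of the two known states; by \<open>same\<close> it does not matter
    which.\<close>
  have "sent A C n (run A C n wm \<rho> t v) = sent A C n (run A C n w \<rho> t v)" if v: "v \<in> {1..n}" for v
  proof (cases "pos v + t < l")
    case False
    then have "t < pos v"
      using T t by linarith
    then show ?thesis
      using Suc.IH[OF t(2) v] same[OF v] by simp
  qed (use Suc.IH[OF t(2) v] in simp)
  then have glob: "global_in A C n (run A C n wm \<rho> t) u = global_in A C n (run A C n w \<rho> t) u"
      "global_in A C n (run A C n wm \<rho> t) u = global_in A C n (run A C n w' \<rho> t) u"
    using Suc.prems(2) same by (auto intro!: global_in_cong)
  have node: "v \<in> {1..n}" "pos v \<le> Suc (pos u)" "pos u \<le> Suc (pos v)" if edge: "0 < wm u v" for v
  proof -
    have "wm v u = wm u v"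
      using wm unfolding wgraph_def by blast
    then show "pos v \<le> Suc (pos u)" "pos u \<le> Suc (pos v)"
      using layers[of u v] layers[of v u] edge by simp_all
    show "v \<in> {1..n}"
      using wm edge unfolding wgraph_def by blast
  qed
  show ?case
  proof (intro conjI impI)
    \<comment> \<open>Neighbours differ by at most one layer, so they satisfy the induction
      hypothesis one round earlier: the region of agreement shrinks by one layer per round.\<close>
    assume pos: "pos u + Suc t < l"
    have "(\<lambda>v. if 0 < wm u v then Some (h_lsend A (run A C n wm \<rho> t v) u) else None)
        = (\<lambda>v. if 0 < w u v then Some (h_lsend A (run A C n w \<rho> t v) u) else None)"
    proof
      fix v
      have "run A C n wm \<rho> t v = run A C n w \<rho> t v" if "0 < wm u v"
        using Suc.IH[OF t(2) node(1)[OF that]] node(2,3)[OF that] pos by auto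
      then show "(if 0 < wm u v then Some (h_lsend A (run A C n wm \<rho> t v) u) else None)
        = (if 0 < w u v then Some (h_lsend A (run A C n w \<rho> t v) u) else None)"
        using pos left[OF Suc.prems(2)] by simp
    qed
    then show "run A C n wm \<rho> (Suc t) u = run A C n w \<rho> (Suc t) u"
      using pos Suc.IH[OF t(2) Suc.prems(2)] glob by simp
  next
    assume pos: "Suc t < pos u"
    have "(\<lambda>v. if 0 < wm u v then Some (h_lsend A (run A C n wm \<rho> t v) u) else None)
        = (\<lambda>v. if 0 < w' u v then Some (h_lsend A (run A C n w' \<rho> t v) u) else None)"
    proof
      fix v
      have "run A C n wm \<rho> t v = run A C n w' \<rho> t v" if "0 < wm u v"
        using Suc.IH[OF t(2) node(1)[OF that]] node(2,3)[OF that] pos by auto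
      then show "(if 0 < wm u v then Some (h_lsend A (run A C n wm \<rho> t v) u) else None)
        = (if 0 < w' u v then Some (h_lsend A (run A C n w' \<rho> t v) u) else None)"
        using pos right[OF Suc.prems(2)] by simp
    qed
    then show "run A C n wm \<rho> (Suc t) u = run A C n w' \<rho> (Suc t) u"
      using pos Suc.IH[OF t(2) Suc.prems(2)] glob by simp
  qed
qed

text \<open>This is the rectangle property of transcripts: by \<open>run_mixed\<close> each node is
  in a state that it has under \<open>w\<close> or under \<open>w'\<close>, and \<open>eq\<close>
  says that both send the same messages.\<close>

lemma transcript_mixed:
  assumes "wgraph n wm"
    and "\<And>u. u \<in> {1..n} \<Longrightarrow> pos u < l \<Longrightarrow> wm u = w u"
    and "\<And>u. u \<in> {1..n} \<Longrightarrow> 0 < pos u \<Longrightarrow> wm u = w' u"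
    and "\<And>u v. 0 < wm u v \<Longrightarrow> pos v \<le> Suc (pos u)"
    and eq: "transcript A C n w \<rho> T = transcript A C n w' \<rho> T"
    and T: "2 * T \<le> l"
  shows "transcript A C n wm \<rho> T = transcript A C n w \<rho> T"
  unfolding transcript_eq_iff
proof (intro allI impI ballI)
  fix t v assume t: "t < T" and v: "v \<in> {1..n}"
  note mixed = run_mixed[OF assms, where t = t and u = v]
  show "sent A C n (run A C n wm \<rho> t v) = sent A C n (run A C n w \<rho> t v)"
  proof (cases "pos v + t < l")
    case False
    then have "t < pos v"
      using T t by linarith
    then have "run A C n wm \<rho> t v = run A C n w' \<rho> t v"
      using mixed t v by simp
    then show ?thesis
      using eq t v unfolding transcript_eq_iff by auto
  qed (use mixed t v in simp)
qed

section \<open>The graph\<close>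

inductive walk :: "('v \<Rightarrow> 'v \<Rightarrow> nat) \<Rightarrow> 'v \<Rightarrow> 'v \<Rightarrow> nat \<Rightarrow> bool" for w where
  refl: "walk w u u 0"
| step: "0 < w u v \<Longrightarrow> walk w v z L \<Longrightarrow> walk w u z (w u v + L)"

lemma walk_trans: "walk w u v L \<Longrightarrow> walk w v z L' \<Longrightarrow> walk w u z (L + L')"
  by (induction rule: walk.induct) (auto simp: add.assoc intro: walk.step)

lemma walk_edge: "0 < w u v \<Longrightarrow> walk w u v (w u v)"
  using walk.step[OF _ walk.refl, of w u v] by simp

lemma walk_sym:
  assumes sym: "\<And>a b. w a b = w b a" and "walk w u v L"
  shows "walk w v u L"
  using assms(2)
proof (induction rule: walk.induct)
  case (step u v z L)
  then have "walk w v u (w u v)"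
    using walk_edge[of w v u] by (simp add: sym)
  then show ?case
    using walk_trans[OF step.IH, of u "w u v"] by (simp add: add.commute)
qed (rule walk.refl)

lemma walk_map:
  assumes "\<And>a b. 0 < w a b \<Longrightarrow> w' (e a) (e b) = w a b" and "walk w u v L"
  shows "walk w' (e u) (e v) L"
  using assms(2)
proof (induction rule: walk.induct)
  case (step u v z L)
  then show ?case
    using walk.step[of w' "e u" "e v" "e z" L] assms(1) by simp
qed (rule walk.refl)

lemma walk_potential:
  fixes \<phi> :: "'v \<Rightarrow> nat"
  assumes "\<And>a b. 0 < w a b \<Longrightarrow> \<phi> a \<le> w a b + \<phi> b" and "walk w u v L"
  shows "\<phi> u \<le> L + \<phi> v"
  using assms(2)
proof (induction rule: walk.induct)
  case (step u v z L)
  then show ?case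
    using assms(1)[of u v] by linarith
qed simp

lemma is_path_Cons: "is_path w u v (a # b # p) \<longleftrightarrow> a = u \<and> 0 < w a b \<and> is_path w b v (b # p)"
  unfolding is_path_def by (auto simp: nth_Cons split: nat.split)

lemma path_weight_Cons: "path_weight w (a # b # p) = w a b + path_weight w (b # p)"
  by (simp add: path_weight_def sum.lessThan_Suc_shift del: sum.lessThan_Suc)

text \<open>Walks make sense on any node type, so the instance can be studied on symbolic nodes;
  this equivalence carries the results over to \<open>gdist\<close>.\<close>

lemma walk_iff_path: "walk w u v L \<longleftrightarrow> (\<exists>p. is_path w u v p \<and> path_weight w p = L)"
proof
  assume "walk w u v L"
  then show "\<exists>p. is_path w u v p \<and> path_weight w p = L"
  proof (induction rule: walk.induct)
    case (refl u)
    have "is_path w u u [u] \<and> path_weight w [u] = 0"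
      by (simp add: is_path_def path_weight_def)
    then show ?case
      by blast
  next
    case (step u v z L)
    then obtain p where p: "is_path w v z p" "path_weight w p = L"
      by blast
    then obtain q where "p = v # q"
      by (cases p) (auto simp: is_path_def)
    then have "is_path w u z (u # p) \<and> path_weight w (u # p) = w u v + L"
      using p step.hyps by (simp add: is_path_Cons path_weight_Cons)
    then show ?case
      by blast
  qed
next
  assume "\<exists>p. is_path w u v p \<and> path_weight w p = L"
  then obtain p where "is_path w u v p" "path_weight w p = L"
    by blast
  then show "walk w u v L"
  proof (induction p arbitrary: u L)
    case (Cons a p)
    show ?case
    proof (cases p)
      case Nil
      then show ?thesis
        using Cons.prems by (auto simp: is_path_def path_weight_def intro: walk.refl)
    next
      case (Cons b q)
      then show ?thesis
        using Cons.IH[of b "path_weight w p"] Cons.prems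
        by (auto simp: is_path_Cons path_weight_Cons intro: walk.step)
    qed
  qed (simp add: is_path_def)
qed

lemma gdist_le: "walk w u v L \<Longrightarrow> gdist w u v \<le> L"
  unfolding gdist_def walk_iff_path[symmetric] by (rule Least_le)

lemma walk_gdist: "walk w u v L \<Longrightarrow> walk w u v (gdist w u v)"
  unfolding gdist_def walk_iff_path[symmetric] by (rule LeastI)

lemma ecc_le: "ecc n w u \<le> L" if "1 \<le> n" "\<And>v. v \<in> {1..n} \<Longrightarrow> gdist w u v \<le> L"
  unfolding ecc_def using that by (subst Max_le_iff) auto

lemma radius_le: "radius n w \<le> ecc n w u" if "u \<in> {1..n}"
  unfolding radius_def using that by (intro Min_le) auto

lemma le_radius:
  assumes "1 \<le> n" "\<And>u. u \<in> {1..n} \<Longrightarrow> \<exists>v\<in>{1..n}. L \<le> gdist w u v"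
  shows "L \<le> radius n w"
proof -
  have "L \<le> ecc n w u" if u: "u \<in> {1..n}" for u
  proof -
    obtain v where "v \<in> {1..n}" "L \<le> gdist w u v"
      using assms(2)[OF u] by blast
    moreover from this have "gdist w u v \<le> ecc n w u"
      unfolding ecc_def by (intro Max_ge) auto
    ultimately show ?thesis
      by linarith
  qed
  then show ?thesis
    unfolding radius_def using assms(1) by (subst Min_ge_iff) auto
qed

text \<open>The instance for inputs \<open>x, y \<subseteq> [k] \<times> [k]\<close>: \<open>U i\<close> and \<open>V i\<close> are the row nodes at the two
  ends, \<open>P j 0, \<dots>, P j l\<close> are \<open>2k\<close> paths between the ends. Edges along these and along the
  pendant path below have weight 1, all others weight \<open>M\<close>. For \<open>j < k\<close> the edges at the ends of path \<open>j\<close> carry the inputs; path \<open>k + m\<close> gives every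
  \<open>U i\<close> with \<open>i \<noteq> m\<close> a short way to \<open>V m\<close>, so that only the pairs \<open>U i\<close>, \<open>V i\<close> depend on the input.
  \<open>Hub\<close> brings every \<open>U i\<close> close to all paths, and the pendant path \<open>Q 0, \<dots>, Q l\<close> with the leaves
  \<open>D m\<close> makes every node other than a \<open>U i\<close> too eccentric to be a centre. The number of leaves
  adjusts the number of nodes.\<close>

datatype node = U nat | V nat | P nat nat | Q nat | Hub | D nat

definition colx :: "nat \<Rightarrow> (nat \<times> nat) set \<Rightarrow> nat \<Rightarrow> nat \<Rightarrow> bool" where
  "colx k x i j \<longleftrightarrow> (if j < k then (i, j) \<in> x else j \<noteq> k + i)"

definition coly :: "nat \<Rightarrow> (nat \<times> nat) set \<Rightarrow> nat \<Rightarrow> nat \<Rightarrow> bool" where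
  "coly k y i j \<longleftrightarrow> (if j < k then (i, j) \<in> y else j = k + i)"

definition nodes :: "nat \<Rightarrow> nat \<Rightarrow> nat \<Rightarrow> node set" where
  "nodes k l r = U ` {..<k} \<union> V ` {..<k} \<union> (\<lambda>(j, h). P j h) ` ({..<2 * k} \<times> {..l}) \<union> Q ` {..l} \<union> {Hub} \<union> D ` {..<r}"

fun arc :: "nat \<Rightarrow> nat \<Rightarrow> nat \<Rightarrow> (nat \<times> nat) set \<Rightarrow> (nat \<times> nat) set \<Rightarrow> node \<Rightarrow> node \<Rightarrow> nat" where
  "arc k l M x y (U i) (P j h) = (if h = 0 \<and> colx k x i j then M else 0)"
| "arc k l M x y (V i) (P j h) = (if h = l \<and> coly k y i j then M else 0)"
| "arc k l M x y (U i) Hub = M"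
| "arc k l M x y Hub (P j h) = (if h = 0 then M else 0)"
| "arc k l M x y (U i) (Q h) = (if h = 0 then M else 0)"
| "arc k l M x y (Q h) (D m) = (if h = l then M else 0)"
| "arc k l M x y (P j h) (P j' h') = (if j = j' \<and> h' = Suc h then 1 else 0)"
| "arc k l M x y (Q h) (Q h') = (if h' = Suc h then 1 else 0)"
| "arc k l M x y _ _ = 0"

text \<open>\<open>arc\<close> gives each edge in one orientation only; the maximum symmetrises it,
  and the restriction cuts the infinite type \<open>node\<close> down to the graph.\<close>

definition wt :: "nat \<Rightarrow> nat \<Rightarrow> nat \<Rightarrow> nat \<Rightarrow> (nat \<times> nat) set \<Rightarrow> (nat \<times> nat) set \<Rightarrow> node \<Rightarrow> node \<Rightarrow> nat" where
  "wt k l r M x y a b = (if a \<in> nodes k l r \<and> b \<in> nodes k l r then max (arc k l M x y a b) (arc k l M x y b a) else 0)"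

text \<open>The position between the two ends, used as \<open>pos\<close> in
  \<open>run_mixed\<close>: \<open>x\<close> affects only edges within layer 0 and \<open>y\<close>
  only edges within layer \<open>l\<close>. Hub, pendant path and leaves are all put into layer
  0.\<close>

fun layer :: "nat \<Rightarrow> node \<Rightarrow> nat" where
  "layer l (V i) = l"
| "layer l (P j h) = h"
| "layer l _ = 0"

lemma card_nodes: "finite (nodes k l r)" "card (nodes k l r) = 2 * k * (l + 2) + l + 2 + r"
proof -
  have inj: "inj_on (\<lambda>(j, h). P j h) B" for B
    by (auto simp: inj_on_def)
  show "finite (nodes k l r)"
    by (simp add: nodes_def)
  have "card (nodes k l r) = card (U ` {..<k}) + card (V ` {..<k})
      + card ((\<lambda>(j, h). P j h) ` ({..<2 * k} \<times> {..l})) + card (Q ` {..l}) + card {Hub} + card (D ` {..<r})"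
    unfolding nodes_def by (subst card_Un_disjoint; (auto; fail)?)+
  also have "\<dots> = 2 * k * (l + 2) + l + 2 + r"
    by (simp add: card_image inj inj_on_def card_cartesian_product algebra_simps)
  finally show "card (nodes k l r) = 2 * k * (l + 2) + l + 2 + r" .
qed

lemma node_mem [simp]:
  "U i \<in> nodes k l r \<longleftrightarrow> i < k" "V i \<in> nodes k l r \<longleftrightarrow> i < k"
  "P j h \<in> nodes k l r \<longleftrightarrow> j < 2 * k \<and> h \<le> l" "Q h \<in> nodes k l r \<longleftrightarrow> h \<le> l"
  "Hub \<in> nodes k l r" "D m \<in> nodes k l r \<longleftrightarrow> m < r"
  by (auto simp: nodes_def)

lemma wt_sym: "wt k l r M x y a b = wt k l r M x y b a"
  by (simp add: wt_def max.commute)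

lemma wt_self: "wt k l r M x y a a = 0"
  by (cases a) (auto simp: wt_def)

lemma wt_le: "wt k l r M x y a b \<le> max 1 M"
proof -
  have "arc k l M x y a b \<le> max 1 M" for a b
    by (cases "(k, l, M, x, y, a, b)" rule: arc.cases) auto
  then show ?thesis
    by (simp add: wt_def)
qed

lemma wt_left: "layer l a < l \<Longrightarrow> wt k l r M x y a b = wt k l r M x y' a b"
  by (cases a; cases b) (auto simp: wt_def)

lemma wt_right: "0 < layer l a \<Longrightarrow> wt k l r M x y a b = wt k l r M x' y a b"
  by (cases a; cases b) (auto simp: wt_def)

lemma wt_layers: "0 < wt k l r M x y a b \<Longrightarrow> layer l b \<le> Suc (layer l a)"
  by (cases a; cases b) (auto simp: wt_def split: if_splits)

text \<open>A potential that changes by at most the weight along every edge bounds distances from below;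
  these two are used for the distances to the leaves and to \<open>V m\<close>.\<close>

definition pot_pendant :: "nat \<Rightarrow> nat \<Rightarrow> node \<Rightarrow> nat" where
  "pot_pendant l M a = (case a of D _ \<Rightarrow> 0 | Q h \<Rightarrow> M + (l - h) | U _ \<Rightarrow> 2 * M + l | _ \<Rightarrow> 3 * M + l)"

definition pot_target :: "nat \<Rightarrow> nat \<Rightarrow> nat \<Rightarrow> (nat \<times> nat) set \<Rightarrow> (nat \<times> nat) set \<Rightarrow> nat \<Rightarrow> node \<Rightarrow> nat" where
  "pot_target k l M x y m a = (case a of
      V i \<Rightarrow> if i = m then 0 else 2 * M
    | P j h \<Rightarrow> (if coly k y m j then M else 3 * M) + (l - h)
    | Hub \<Rightarrow> 2 * M + l
    | U i \<Rightarrow> if \<exists>j<2 * k. colx k x i j \<and> coly k y m j then 2 * M + l else 3 * M + l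
    | _ \<Rightarrow> 3 * M + l)"

lemma wt_lipschitz:
  fixes \<phi> :: "node \<Rightarrow> nat"
  assumes "\<And>a b. a \<in> nodes k l r \<Longrightarrow> b \<in> nodes k l r \<Longrightarrow> 0 < arc k l M x y a b \<Longrightarrow>
      \<phi> a \<le> arc k l M x y a b + \<phi> b \<and> \<phi> b \<le> arc k l M x y a b + \<phi> a"
    and "0 < wt k l r M x y a b"
  shows "\<phi> a \<le> wt k l r M x y a b + \<phi> b"
proof -
  have ab: "a \<in> nodes k l r" "b \<in> nodes k l r"
    and w: "wt k l r M x y a b = max (arc k l M x y a b) (arc k l M x y b a)"
    using assms(2) by (auto simp: wt_def split: if_splits)
  then have "0 < arc k l M x y a b \<or> 0 < arc k l M x y b a"
    using assms(2) by auto
  then show ?thesis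
    using assms(1)[OF ab] assms(1)[OF ab(2,1)] w by auto
qed

lemma pot_pendant_lipschitz:
  assumes "0 < wt k l r M x y a b"
  shows "pot_pendant l M a \<le> wt k l r M x y a b + pot_pendant l M b"
proof (rule wt_lipschitz[OF _ assms])
  fix a b assume "0 < arc k l M x y a b" "a \<in> nodes k l r" "b \<in> nodes k l r"
  then show "pot_pendant l M a \<le> arc k l M x y a b + pot_pendant l M b \<and>
      pot_pendant l M b \<le> arc k l M x y a b + pot_pendant l M a"
    by (cases a; cases b; simp add: pot_pendant_def split: if_splits)
qed

lemma pot_target_lipschitz:
  assumes "0 < wt k l r M x y a b"
  shows "pot_target k l M x y m a \<le> wt k l r M x y a b + pot_target k l M x y m b"
proof (rule wt_lipschitz[OF _ assms])
  fix a b assume ab: "0 < arc k l M x y a b" "a \<in> nodes k l r" "b \<in> nodes k l r"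
  show "pot_target k l M x y m a \<le> arc k l M x y a b + pot_target k l M x y m b \<and>
      pot_target k l M x y m b \<le> arc k l M x y a b + pot_target k l M x y m a"
  proof (cases "\<exists>i j h. a = U i \<and> b = P j h")
    \<comment> \<open>An edge from \<open>U i\<close> to a path that reaches \<open>V m\<close> is
      itself a witness for the existential in the potential of \<open>U i\<close>, which therefore
      takes the smaller value.\<close>
    case True
    then obtain i j where "a = U i" "b = P j 0" "colx k x i j" "j < 2 * k"
      using ab by (auto split: if_splits)
    moreover from this have "\<exists>j<2 * k. colx k x i j \<and> coly k y m j" if "coly k y m j"
      using that by blast
    ultimately show ?thesis
      by (auto simp: pot_target_def)
  next
    case False
    then show ?thesis
      using ab by (cases a; cases b; simp add: pot_target_def split: if_splits; (auto; fail)?)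
  qed
qed

text \<open>\<open>U i\<close> is far from \<open>V i\<close>, because no path serves both when the
  inputs are disjoint. The pendant path and the leaves are far from \<open>V 0\<close>, and all
  remaining nodes are far from the leaf \<open>D 0\<close>.\<close>

lemma far_node:
  assumes "x \<inter> y = {}" "a \<in> nodes k l r" "1 \<le> k" "1 \<le> r"
  shows "\<exists>b\<in>nodes k l r. \<forall>L. walk (wt k l r M x y) a b L \<longrightarrow> 3 * M + l \<le> L"
proof -
  have pend: ?thesis if "pot_pendant l M a = 3 * M + l"
    using walk_potential[of "wt k l r M x y" "pot_pendant l M" a "D 0", OF pot_pendant_lipschitz] that assms
    by (intro bexI[of _ "D 0"]) (auto simp: pot_pendant_def)
  have targ: ?thesis if "m < k" "pot_target k l M x y m a = 3 * M + l" for m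
    using walk_potential[of "wt k l r M x y" "pot_target k l M x y m" a "V m", OF pot_target_lipschitz] that assms
    by (intro bexI[of _ "V m"]) (auto simp: pot_target_def)
  show ?thesis
  proof (cases a)
    case (U i)
    have "\<not> (colx k x i j \<and> coly k y i j)" for j
      using assms(1) by (auto simp: colx_def coly_def)
    then show ?thesis
      using assms U by (intro targ[of i]) (auto simp: pot_target_def)
  next
    case (Q h)
    then show ?thesis
      using assms by (intro targ[of 0]) (auto simp: pot_target_def)
  next
    case (D m)
    then show ?thesis
      using assms by (intro targ[of 0]) (auto simp: pot_target_def)
  qed (rule pend, simp add: pot_pendant_def)+
qed

section \<open>Short walks and connectivity\<close>

lemma walk_column:
  assumes "j < 2 * k"
  shows "h \<le> l \<Longrightarrow> walk (wt k l r M x y) (P j 0) (P j h) h"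
proof (induction h)
  case (Suc h)
  have "wt k l r M x y (P j h) (P j (Suc h)) = 1"
    using Suc.prems assms by (simp add: wt_def)
  then have "walk (wt k l r M x y) (P j h) (P j (Suc h)) 1"
    using walk_edge[of "wt k l r M x y" "P j h" "P j (Suc h)"] by simp
  then show ?case
    using walk_trans Suc by fastforce
qed (rule walk.refl)

lemma walk_pendant: "h \<le> l \<Longrightarrow> walk (wt k l r M x y) (Q 0) (Q h) h"
proof (induction h)
  case (Suc h)
  have "wt k l r M x y (Q h) (Q (Suc h)) = 1"
    using Suc.prems by (simp add: wt_def)
  then have "walk (wt k l r M x y) (Q h) (Q (Suc h)) 1"
    using walk_edge[of "wt k l r M x y" "Q h" "Q (Suc h)"] by simp
  then show ?case
    using walk_trans Suc by fastforce
qed (rule walk.refl)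

lemma walk_wt: "wt k l r M x y a b = L \<Longrightarrow> 0 < L \<Longrightarrow> walk (wt k l r M x y) a b L"
  using walk_edge[of "wt k l r M x y" a b] by simp

lemma walk_via_column:
  assumes "1 \<le> M" "i < k" "m < k" "j < 2 * k" "colx k x i j" "coly k y m j"
  shows "walk (wt k l r M x y) (U i) (V m) (2 * M + l)"
proof -
  have "walk (wt k l r M x y) (U i) (P j 0) M" "walk (wt k l r M x y) (P j l) (V m) M"
    using assms by (auto intro!: walk_wt simp: wt_def)
  from walk_trans[OF walk_trans[OF this(1) walk_column] this(2)] show ?thesis
    using assms(4) by (simp add: mult_2 add_ac)
qed

text \<open>Independently of the input, \<open>Hub\<close> leads to the paths and to the other
  \<open>U m\<close>, and the pendant path leads to the leaves.\<close>

lemma walk_from_U: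
  assumes "1 \<le> M" "i < k" "a \<in> nodes k l r" "\<And>m. a \<noteq> V m"
  shows "\<exists>L\<le>2 * M + l. walk (wt k l r M x y) (U i) a L"
proof -
  let ?w = "walk (wt k l r M x y)"
  have hub: "?w (U i) Hub M" and hubU: "?w Hub (U m) M" if "m < k" for m
    using assms that by (auto intro!: walk_wt simp: wt_def)
  have q: "?w (U i) (Q 0) M"
    using assms by (auto intro!: walk_wt simp: wt_def)
  show ?thesis
  proof (cases a)
    case (U m)
    then have "?w (U i) a (M + M)"
      using assms walk_trans[OF hub hubU] by auto
    then show ?thesis
      by (intro exI[of _ "M + M"]) auto
  next
    case (P j h)
    have "?w Hub (P j 0) M"
      using assms P by (auto intro!: walk_wt simp: wt_def)
    then have "?w (U i) a (M + M + h)"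
      using walk_trans[OF walk_trans[OF hub] walk_column] assms P by simp
    then show ?thesis
      using assms P by (intro exI[of _ "M + M + h"]) auto
  next
    case (Q h)
    then show ?thesis
      using walk_trans[OF q walk_pendant] assms by (intro exI[of _ "M + h"]) auto
  next
    case Hub
    then show ?thesis
      using hub assms by (intro exI[of _ M]) auto
  next
    case (D m)
    then have "?w (Q l) a M"
      using assms by (auto intro!: walk_wt simp: wt_def)
    then have "?w (U i) a (M + l + M)"
      using walk_trans[OF walk_trans[OF q walk_pendant]] by simp
    then show ?thesis
      by (intro exI[of _ "M + l + M"]) auto
  qed (use assms in auto)
qed

text \<open>The end of path \<open>k + m\<close> is joined to \<open>V m\<close> for every
  input.\<close>

lemma walk_connected:
  assumes "1 \<le> M" "i < k" "a \<in> nodes k l r"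
  shows "\<exists>L. walk (wt k l r M x y) (U i) a L"
proof (cases "\<exists>m. a = V m")
  case True
  then obtain m where m: "a = V m" "m < k"
    using assms by auto
  obtain L where "walk (wt k l r M x y) (U i) (P (k + m) l) L"
    using walk_from_U[of M i k "P (k + m) l" l r] assms m by auto
  moreover have "walk (wt k l r M x y) (P (k + m) l) a M"
    using assms m by (auto intro!: walk_wt simp: wt_def coly_def)
  ultimately show ?thesis
    by (intro exI) (rule walk_trans)
next
  case False
  then show ?thesis
    using walk_from_U[OF assms] by blast
qed

text \<open>A common element \<open>(i, j)\<close> opens path \<open>j\<close> from
  \<open>U i\<close> to \<open>V i\<close>; for \<open>m \<noteq> i\<close>, path
  \<open>k + m\<close> leads from \<open>U i\<close> to \<open>V m\<close>.\<close>

lemma central_node: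
  assumes "1 \<le> M" "i < k" "j < k" "(i, j) \<in> x \<inter> y" "a \<in> nodes k l r"
  shows "\<exists>L\<le>2 * M + l. walk (wt k l r M x y) (U i) a L"
proof (cases "\<exists>m. a = V m")
  case True
  then obtain m where m: "a = V m" "m < k"
    using assms by auto
  have "\<exists>c<2 * k. colx k x i c \<and> coly k y m c"
  proof (cases "m = i")
    case True
    then show ?thesis
      using assms by (intro exI[of _ j]) (auto simp: colx_def coly_def)
  next
    case False
    then show ?thesis
      using m by (intro exI[of _ "k + m"]) (auto simp: colx_def coly_def)
  qed
  then obtain c where "c < 2 * k" "colx k x i c" "coly k y m c"
    by blast
  then have "walk (wt k l r M x y) (U i) a (2 * M + l)"
    unfolding m(1) by (intro walk_via_column assms m(2))
  then show ?thesis
    by blast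
next
  case False
  then show ?thesis
    using walk_from_U[OF assms(1,2,5)] by blast
qed

section \<open>The instance on numbered nodes and its radius\<close>

definition inst :: "nat \<Rightarrow> (nat \<Rightarrow> node) \<Rightarrow> nat \<Rightarrow> nat \<Rightarrow> nat \<Rightarrow> nat \<Rightarrow> (nat \<times> nat) set \<Rightarrow> (nat \<times> nat) set \<Rightarrow> nat \<Rightarrow> nat \<Rightarrow> nat" where
  "inst n dec k l r M x y u v = (if u \<in> {1..n} \<and> v \<in> {1..n} then wt k l r M x y (dec u) (dec v) else 0)"

lemma wgraph_inst: "wgraph n (inst n dec k l r M x y)"
proof -
  have "inst n dec k l r M x y u v = inst n dec k l r M x y v u" for u v
    unfolding inst_def by (simp add: wt_sym[of k l r M x y "dec u"] conj_commute)
  then show ?thesis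
    unfolding wgraph_def by (auto simp: inst_def wt_self split: if_splits)
qed

lemma walk_inst:
  assumes bij: "bij_betw dec {1..n} (nodes k l r)" and "u \<in> {1..n}" "v \<in> {1..n}"
  shows "walk (inst n dec k l r M x y) u v L \<longleftrightarrow> walk (wt k l r M x y) (dec u) (dec v) L"
proof
  show "walk (wt k l r M x y) (dec u) (dec v) L" if "walk (inst n dec k l r M x y) u v L"
    by (rule walk_map[OF _ that]) (auto simp: inst_def split: if_splits)
next
  let ?e = "inv_into {1..n} dec"
  assume "walk (wt k l r M x y) (dec u) (dec v) L"
  then have "walk (inst n dec k l r M x y) (?e (dec u)) (?e (dec v)) L"
  proof (rule walk_map[rotated])
    fix a b assume "0 < wt k l r M x y a b"
    then have ab: "a \<in> nodes k l r" "b \<in> nodes k l r"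
      by (auto simp: wt_def split: if_splits)
    then show "inst n dec k l r M x y (?e a) (?e b) = wt k l r M x y a b"
      using bij_betw_inv_into_right[OF bij] bij_betwE[OF bij_betw_inv_into[OF bij]]
      by (simp add: inst_def)
  qed
  then show "walk (inst n dec k l r M x y) u v L"
    using assms bij_betw_inv_into_left[OF bij] by simp
qed

lemma connected_inst:
  assumes bij: "bij_betw dec {1..n} (nodes k l r)" and "1 \<le> M" "1 \<le> k"
  shows "connected_graph n (inst n dec k l r M x y)"
  unfolding connected_graph_def
proof (intro ballI)
  fix u v assume uv: "u \<in> {1..n}" "v \<in> {1..n}"
  then have "dec u \<in> nodes k l r" "dec v \<in> nodes k l r"
    using bij by (auto dest: bij_betwE)
  then obtain L L' where walks: "walk (wt k l r M x y) (U 0) (dec u) L" "walk (wt k l r M x y) (U 0) (dec v) L'"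
    using walk_connected[of M 0 k _ l r x y] assms(2,3) by fastforce
  have "walk (wt k l r M x y) (dec u) (dec v) (L + L')"
    by (rule walk_trans[OF walk_sym[OF wt_sym walks(1)] walks(2)])
  then show "\<exists>p. is_path (inst n dec k l r M x y) u v p"
    using walk_inst[OF bij uv] walk_iff_path by blast
qed

lemma radius_inst_intersecting:
  assumes bij: "bij_betw dec {1..n} (nodes k l r)" and M: "1 \<le> M"
    and ij: "i < k" "j < k" "(i, j) \<in> x \<inter> y"
  shows "radius n (inst n dec k l r M x y) \<le> 2 * M + l"
proof -
  have "U i \<in> dec ` {1..n}"
    using bij ij by (simp add: bij_betw_def)
  then obtain u where u: "u \<in> {1..n}" "dec u = U i"
    by auto
  have "gdist (inst n dec k l r M x y) u v \<le> 2 * M + l" if v: "v \<in> {1..n}" for v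
  proof -
    have "dec v \<in> nodes k l r"
      using bij v by (auto dest: bij_betwE)
    then obtain L where "L \<le> 2 * M + l" "walk (inst n dec k l r M x y) u v L"
      using central_node[OF M ij] u walk_inst[OF bij u(1) v] by metis
    then show ?thesis
      using gdist_le order_trans by blast
  qed
  then have "ecc n (inst n dec k l r M x y) u \<le> 2 * M + l"
    using u by (intro ecc_le) auto
  then show ?thesis
    using radius_le[OF u(1)] order_trans by blast
qed

lemma radius_inst_disjoint:
  assumes bij: "bij_betw dec {1..n} (nodes k l r)" and "1 \<le> M" "1 \<le> k" "1 \<le> r" "x \<inter> y = {}"
  shows "3 * M + l \<le> radius n (inst n dec k l r M x y)"
proof (rule le_radius)
  have "Hub \<in> dec ` {1..n}"
    using bij by (simp add: bij_betw_def)
  then show "1 \<le> n"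
    by auto
next
  fix u assume u: "u \<in> {1..n}"
  then have "dec u \<in> nodes k l r"
    using bij by (auto dest: bij_betwE)
  then obtain b where b: "b \<in> nodes k l r" "\<And>L. walk (wt k l r M x y) (dec u) b L \<Longrightarrow> 3 * M + l \<le> L"
    using far_node assms by blast
  have "b \<in> dec ` {1..n}"
    using b bij by (simp add: bij_betw_def)
  then obtain v where v: "v \<in> {1..n}" "dec v = b"
    by auto
  \<comment> \<open>\<open>gdist\<close> is a \<open>LEAST\<close>, so a walk must exist before its
    value is known to be the length of one.\<close>
  obtain L where "walk (inst n dec k l r M x y) u v L"
    using connected_inst[OF assms(1-3)] u v unfolding connected_graph_def walk_iff_path by blast
  then have "walk (inst n dec k l r M x y) u v (gdist (inst n dec k l r M x y) u v)"
    by (rule walk_gdist)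
  then show "\<exists>v\<in>{1..n}. 3 * M + l \<le> gdist (inst n dec k l r M x y) u v"
    using b(2) v walk_inst[OF bij u v(1)] by blast
qed

section \<open>Lower bound on the number of rounds\<close>

lemma expectation_pavg:
  fixes F :: "'r \<Rightarrow> 'a set \<Rightarrow> real"
  assumes "\<And>X. integrable (measure_pmf p) (\<lambda>\<rho>. F \<rho> X)"
  shows "integrable (measure_pmf p) (\<lambda>\<rho>. pavg S (F \<rho>))"
    "measure_pmf.expectation p (\<lambda>\<rho>. pavg S (F \<rho>)) = pavg S (\<lambda>X. measure_pmf.expectation p (\<lambda>\<rho>. F \<rho> X))"
  using assms by (simp_all add: pavg_def Bochner_Integration.integral_sum)

lemma expectation_of_bool:
  "integrable (measure_pmf p) (\<lambda>\<rho>. of_bool (E \<rho>) :: real)"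
  "measure_pmf.expectation p (\<lambda>\<rho>. of_bool (E \<rho>) :: real) = measure_pmf.prob p {\<rho>. E \<rho>}"
proof -
  show "integrable (measure_pmf p) (\<lambda>\<rho>. of_bool (E \<rho>) :: real)"
    by (rule measure_pmf.integrable_const_bound[where B = 1]) auto
  have "(\<lambda>\<rho>. of_bool (E \<rho>) :: real) = indicator {\<rho>. E \<rho>}"
    by (auto simp: indicator_def)
  then show "measure_pmf.expectation p (\<lambda>\<rho>. of_bool (E \<rho>) :: real) = measure_pmf.prob p {\<rho>. E \<rho>}"
    by simp
qed

text \<open>In expectation over the coins each of the \<open>card I * 2 ^ (card I - 1)\<close>
  summands is at least \<open>2/3 - 1/3\<close>; some fixed seed reaches the expectation of the
  total.\<close>

lemma good_seed:
  fixes acc :: "'r \<Rightarrow> 'a set \<Rightarrow> 'a set \<Rightarrow> bool"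
  assumes fin: "finite I"
    and hit: "\<And>i x y. i \<in> I \<Longrightarrow> i \<in> x \<inter> y \<Longrightarrow> x \<subseteq> I \<Longrightarrow> y \<subseteq> I \<Longrightarrow> 2 / 3 \<le> measure_pmf.prob p {\<rho>. acc \<rho> x y}"
    and miss: "\<And>x y. x \<inter> y = {} \<Longrightarrow> x \<subseteq> I \<Longrightarrow> y \<subseteq> I \<Longrightarrow> measure_pmf.prob p {\<rho>. acc \<rho> x y} \<le> 1 / 3"
  shows "\<exists>\<rho>. card I * 2 ^ (card I - 1) / 3 \<le> (\<Sum>i\<in>I. \<Sum>d\<in>Pow (I - {i}).
        pavg (I - {i} - d) (\<lambda>X. pavg d (\<lambda>Y. of_bool (acc \<rho> (insert i X) (insert i Y)) - of_bool (acc \<rho> X Y))))"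
proof (rule ccontr)
  let ?D = "\<lambda>\<rho> i d. pavg (I - {i} - d) (\<lambda>X. pavg d (\<lambda>Y.
      of_bool (acc \<rho> (insert i X) (insert i Y)) - of_bool (acc \<rho> X Y)))"
  assume "\<not> ?thesis"
  then have less: "(\<Sum>i\<in>I. \<Sum>d\<in>Pow (I - {i}). ?D \<rho> i d) < card I * 2 ^ (card I - 1) / 3" for \<rho>
    by (meson not_le)
  have integ: "integrable (measure_pmf p) (\<lambda>\<rho>. of_bool (acc \<rho> (insert i X) (insert i Y)) - of_bool (acc \<rho> X Y) :: real)"
    for i X Y by (intro Bochner_Integration.integrable_diff expectation_of_bool)
  have integD: "integrable (measure_pmf p) (\<lambda>\<rho>. ?D \<rho> i d)" for i d
    by (intro expectation_pavg integ)
  have ED: "1 / 3 \<le> measure_pmf.expectation p (\<lambda>\<rho>. ?D \<rho> i d)" if i: "i \<in> I" and d: "d \<in> Pow (I - {i})" for i d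
  proof -
    have fins: "finite (I - {i} - d)" "finite d"
      using fin d by (auto intro: finite_subset)
    have "1 / 3 = pavg (I - {i} - d) (\<lambda>X. pavg d (\<lambda>Y. 1 / 3))"
      by (simp add: pavg_const fins)
    also have "\<dots> \<le> pavg (I - {i} - d) (\<lambda>X. pavg d (\<lambda>Y.
        measure_pmf.prob p {\<rho>. acc \<rho> (insert i X) (insert i Y)} - measure_pmf.prob p {\<rho>. acc \<rho> X Y}))"
    proof (intro pavg_mono)
      fix X Y assume XY: "X \<subseteq> I - {i} - d" "Y \<subseteq> d"
      have "2 / 3 \<le> measure_pmf.prob p {\<rho>. acc \<rho> (insert i X) (insert i Y)}"
        by (rule hit[of i]) (use XY i d in auto)
      moreover have "measure_pmf.prob p {\<rho>. acc \<rho> X Y} \<le> 1 / 3"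
        by (rule miss) (use XY i d in auto)
      ultimately show "1 / 3 \<le> measure_pmf.prob p {\<rho>. acc \<rho> (insert i X) (insert i Y)} - measure_pmf.prob p {\<rho>. acc \<rho> X Y}"
        by linarith
    qed
    also have "\<dots> = measure_pmf.expectation p (\<lambda>\<rho>. ?D \<rho> i d)"
      by (simp add: expectation_pavg integ Bochner_Integration.integral_diff expectation_of_bool)
    finally show ?thesis .
  qed
  have "card I * 2 ^ (card I - 1) / 3 = (\<Sum>i\<in>I. \<Sum>d\<in>Pow (I - {i}). 1 / 3 :: real)"
    using fin by (simp add: card_Pow)
  also have "\<dots> \<le> (\<Sum>i\<in>I. \<Sum>d\<in>Pow (I - {i}). measure_pmf.expectation p (\<lambda>\<rho>. ?D \<rho> i d))"
    by (intro sum_mono ED)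
  also have "\<dots> = measure_pmf.expectation p (\<lambda>\<rho>. \<Sum>i\<in>I. \<Sum>d\<in>Pow (I - {i}). ?D \<rho> i d)"
    by (simp add: Bochner_Integration.integral_sum integD)
  also have "\<dots> < card I * 2 ^ (card I - 1) / 3"
    by (intro measure_pmf.expectation_less Bochner_Integration.integrable_sum integD AE_I2 less)
  finally show False
    by simp
qed

lemma radius_approx_transcripts:
  fixes A :: "('s, 'm, 'r, 'z) hybrid_alg_scheme"
  assumes alg: "hybrid_radius_approx A C n T W \<alpha>"
    and k: "1 \<le> k" and n: "2 * k * (l + 2) + l + 3 \<le> n" and M: "1 \<le> M" "M \<le> W"
    and \<alpha>: "0 \<le> \<alpha>" "\<alpha> * real (2 * M + l) < real (3 * M + l)"
    and l: "1 \<le> l" and T: "2 * T \<le> l"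
  shows "real (k * k) / 576 \<le> ln (2 * real (card (transcripts C n T)))"
proof -
  \<comment> \<open>The leaves fill the graph up to exactly \<open>n\<close> nodes; the size
    hypothesis leaves room for at least one.\<close>
  define r where "r = n - (2 * k * (l + 2) + l + 2)"
  have r: "1 \<le> r" "card (nodes k l r) = n"
    using n by (auto simp: r_def card_nodes)
  \<comment> \<open>The numbering is the same for all inputs, so graphs that share an input agree at
    the corresponding end.\<close>
  obtain dec where bij: "bij_betw dec {1..n} (nodes k l r)"
    using ex_bij_betw_nat_finite_1[OF card_nodes(1)[of k l r]] r by auto
  have "U 0 \<in> dec ` {1..n}"
    using bij k by (simp add: bij_betw_def)
  then obtain u0 where u0: "u0 \<in> {1..n}" "dec u0 = U 0"
    by auto
  define G where "G x y = inst n dec k l r M x y" for x y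
  define I where "I = {..<k} \<times> {..<k}"
  \<comment> \<open>The output of \<open>u0\<close> is compared with the gap: on success it lies
    below \<open>3 * M + l\<close> for intersecting inputs and not below it for disjoint
    ones.\<close>
  define acc where "acc \<rho> x y \<longleftrightarrow> h_output A (run A C n (G x y) \<rho> T u0) < real (3 * M + l)" for \<rho> x y
  have succ: "2 / 3 \<le> measure_pmf.prob (seeds A n) {\<rho>. success A C n (G x y) T \<alpha> \<rho>}" for x y
  proof -
    have "G x y u v \<le> W" for u v
      using wt_le[of k l r M x y "dec u" "dec v"] M by (auto simp: G_def inst_def)
    then show ?thesis
      using alg wgraph_inst connected_inst[OF bij M(1) k] unfolding hybrid_radius_approx_def G_def by blast
  qed
  have finI: "finite I"
    by (simp add: I_def)
  have "\<exists>\<rho>. card I * 2 ^ (card I - 1) / 3 \<le> (\<Sum>i\<in>I. \<Sum>d\<in>Pow (I - {i}).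
        pavg (I - {i} - d) (\<lambda>X. pavg d (\<lambda>Y. of_bool (acc \<rho> (insert i X) (insert i Y)) - of_bool (acc \<rho> X Y))))"
  proof (rule good_seed[OF finI, where p = "seeds A n"])
    fix i x y assume i: "i \<in> I" "i \<in> x \<inter> y"
    then have "radius n (G x y) \<le> 2 * M + l"
      using radius_inst_intersecting[OF bij M(1), of "fst i" "snd i" x y] by (auto simp: I_def G_def)
    then have "\<alpha> * real (radius n (G x y)) \<le> \<alpha> * real (2 * M + l)"
      using \<alpha>(1) by (intro mult_left_mono) (simp_all only: of_nat_le_iff)
    then have "{\<rho>. success A C n (G x y) T \<alpha> \<rho>} \<subseteq> {\<rho>. acc \<rho> x y}"
      using u0(1) \<alpha>(2) unfolding success_def acc_def by fastforce
    then show "2 / 3 \<le> measure_pmf.prob (seeds A n) {\<rho>. acc \<rho> x y}"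
      by (intro order_trans[OF succ[of x y]] measure_pmf.finite_measure_mono) auto
  next
    fix x y :: "(nat \<times> nat) set" assume "x \<inter> y = {}"
    then have "3 * M + l \<le> radius n (G x y)"
      unfolding G_def by (rule radius_inst_disjoint[OF bij M(1) k r(1)])
    then have "real (3 * M + l) \<le> real (radius n (G x y))"
      by (simp only: of_nat_le_iff)
    then have "{\<rho>. acc \<rho> x y} \<subseteq> UNIV - {\<rho>. success A C n (G x y) T \<alpha> \<rho>}"
      using u0(1) unfolding success_def acc_def by fastforce
    then have "measure_pmf.prob (seeds A n) {\<rho>. acc \<rho> x y}
        \<le> measure_pmf.prob (seeds A n) (UNIV - {\<rho>. success A C n (G x y) T \<alpha> \<rho>})"
      by (intro measure_pmf.finite_measure_mono) auto
    also have "\<dots> = 1 - measure_pmf.prob (seeds A n) {\<rho>. success A C n (G x y) T \<alpha> \<rho>}"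
      using measure_pmf.prob_compl[of "{\<rho>. success A C n (G x y) T \<alpha> \<rho>}" "seeds A n"] by simp
    finally show "measure_pmf.prob (seeds A n) {\<rho>. acc \<rho> x y} \<le> 1 / 3"
      using succ[of x y] by linarith
  qed
  then obtain \<rho> where \<rho>: "card I * 2 ^ (card I - 1) / 3 \<le> (\<Sum>i\<in>I. \<Sum>d\<in>Pow (I - {i}).
        pavg (I - {i} - d) (\<lambda>X. pavg d (\<lambda>Y. of_bool (acc \<rho> (insert i X) (insert i Y)) - of_bool (acc \<rho> X Y))))"
    by blast
  \<comment> \<open>The output is not part of the messages, so its verdict is added as one bit; this
    is the factor 2 in the conclusion.\<close>
  define \<tau> where "\<tau> x y = (transcript A C n (G x y) \<rho> T, acc \<rho> x y)" for x y
  have "card I / 576 \<le> ln (card (transcripts C n T \<times> (UNIV :: bool set)))"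
  proof (rule disjointness_transcript_bound[where \<tau> = \<tau> and acc = snd])
    show "\<tau> x y' = \<tau> x y" if eq: "\<tau> x y = \<tau> x' y'" for x x' y y'
    proof -
      have mixed: "wgraph n (G x y')"
        "\<And>u. u \<in> {1..n} \<Longrightarrow> layer l (dec u) < l \<Longrightarrow> G x y' u = G x y u"
        "\<And>u. u \<in> {1..n} \<Longrightarrow> 0 < layer l (dec u) \<Longrightarrow> G x y' u = G x' y' u"
        "\<And>u v. 0 < G x y' u v \<Longrightarrow> layer l (dec v) \<le> Suc (layer l (dec u))"
        "transcript A C n (G x y) \<rho> T = transcript A C n (G x' y') \<rho> T"
        using eq unfolding \<tau>_def G_def
        by (auto simp: wgraph_inst inst_def fun_eq_iff intro!: wt_left wt_right dest: wt_layers split: if_splits)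
      \<comment> \<open>\<open>u0\<close> lies in layer 0 and \<open>T < l\<close>, so even its
        final state is unaffected by changes at the other end.\<close>
      have "run A C n (G x y') \<rho> T u0 = run A C n (G x y) \<rho> T u0"
        using run_mixed[OF mixed T, where t = T and u = u0] u0 T l by auto
      then show ?thesis
        using transcript_mixed[OF mixed T] by (simp add: \<tau>_def acc_def)
    qed
  qed (use finI finite_transcripts transcript_in_transcripts \<rho> in \<open>auto simp: \<tau>_def\<close>)
  then show ?thesis
    by (simp add: I_def card_cartesian_product mult.commute)
qed

section \<open>Choice of parameters and the final estimate\<close>

lemma ln_card_transcripts_le:
  assumes C: "0 < C" and n: "3 \<le> n"
  shows "ln (2 * real (card (transcripts C n T))) \<le> 1 + real n * real T * (2 * C + 3)\<^sup>2 * (ln (real n))\<^sup>2"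
proof -
  define L c where "L = ln (real n)" and "c = real (Suc (cap C n))"
  have "exp 1 \<le> real n"
    using exp_le n by linarith
  then have L: "1 \<le> L"
    unfolding L_def using n by (subst ln_ge_iff) auto
  have "1 / 2 \<le> ln (2 :: real)"
    using ln_2_less_1 ln2_ge_two_thirds by linarith
  then have "L / ln 2 \<le> L / (1 / 2)"
    using L by (intro divide_left_mono) auto
  then have log: "log 2 (real n) \<le> 2 * L" "0 \<le> log 2 (real n)"
    using n by (simp_all add: log_def L_def)
  \<comment> \<open>One unit comes from the ceiling in \<open>cap\<close> and one from
    \<open>Suc\<close>; both are absorbed because \<open>1 \<le> L\<close>.\<close>
  have "c \<le> C * log 2 (real n) + 2"
    using C log(2) unfolding c_def cap_def by simp linarith
  also have "\<dots> \<le> C * (2 * L) + 2 * L"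
    using C log(1) L by (intro add_mono mult_left_mono) auto
  finally have c: "c \<le> (2 * C + 2) * L"
    by (simp add: algebra_simps)
  have c0: "0 \<le> c"
    by (simp add: c_def)
  have "transcripts C n T \<noteq> {}"
    using transcript_in_transcripts by blast
  then have pos: "0 < real (card (transcripts C n T))"
    using finite_transcripts by (simp add: card_gt_0_iff)
  have "real (card (transcripts C n T)) \<le> (real n * 2 ^ Suc (cap C n)) ^ (Suc (cap C n) * n * T)"
    using card_transcripts_le[of n C T] n unfolding of_nat_le_iff[symmetric, where 'a = real] by simp
  then have "ln (real (card (transcripts C n T))) \<le> ln ((real n * 2 ^ Suc (cap C n)) ^ (Suc (cap C n) * n * T))"
    using pos n by (subst ln_le_cancel_iff) auto
  also have "\<dots> = (c * n * T) * (L + c * ln 2)"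
    using n by (simp add: c_def L_def ln_realpow ln_mult algebra_simps del: power_Suc)
  also have "\<dots> \<le> ((2 * C + 2) * L * n * T) * ((2 * C + 3) * L)"
  proof (intro mult_mono)
    have "c * ln 2 \<le> c * 1"
      using c0 ln_2_less_1 by (intro mult_left_mono) auto
    then show "L + c * ln 2 \<le> (2 * C + 3) * L"
      using c by (simp add: algebra_simps)
  qed (use c c0 C L in auto)
  also have "\<dots> \<le> ((2 * C + 3) * L * n * T) * ((2 * C + 3) * L)"
    using C L by (intro mult_right_mono) auto
  finally have "ln (real (card (transcripts C n T))) \<le> real n * real T * (2 * C + 3)\<^sup>2 * L\<^sup>2"
    by (simp add: power2_eq_square mult_ac)
  moreover have "ln (2 * real (card (transcripts C n T))) = ln 2 + ln (real (card (transcripts C n T)))"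
    using pos by (simp add: ln_mult)
  ultimately show ?thesis
    using ln_2_less_1 by (simp add: L_def)
qed

lemma radius_approx_rounds:
  fixes A :: "('s, 'm, 'r, 'z) hybrid_alg_scheme"
  assumes alg: "hybrid_radius_approx A C n T W \<alpha>"
    and C: "0 < C" and n: "13824 \<le> n" and M: "1 \<le> M" "M \<le> W"
    and \<alpha>: "0 \<le> \<alpha>" "\<And>l. l \<le> n \<Longrightarrow> \<alpha> * real (2 * M + l) < real (3 * M + l)"
  shows "1 / (294912 * (2 * C + 3)\<^sup>2) * real n powr (1/3) / (ln (real n)) ^ 2 \<le> real T"
proof -
  define K where "K = (2 * C + 3)\<^sup>2"
  define L where "L = ln (real n)"
  define a where "a = real n powr (1/3)"
  define l where "l = nat \<lfloor>a\<rfloor>"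
  \<comment> \<open>With \<open>l\<close> about \<open>a\<close>, the \<open>2 * k\<close> paths use
    about \<open>a ^ 3 / 4\<close> nodes, which leaves room for everything else.\<close>
  define k where "k = nat \<lfloor>a\<^sup>2 / 8\<rfloor>"
  have a3: "a ^ 3 = real n"
    using n by (simp add: a_def powr_power)
  have a: "24 \<le> a"
  proof (rule ccontr)
    assume "\<not> 24 \<le> a"
    then have "a ^ 3 < 24 ^ 3"
      by (intro power_strict_mono) (auto simp: a_def)
    then show False
      using n by (simp add: a3)
  qed
  have K: "9 \<le> K"
    unfolding K_def using C power_mono[of 3 "2 * C + 3" 2] by simp
  have "exp 1 \<le> real n"
    using exp_le n by linarith
  then have L: "1 \<le> L"
    unfolding L_def using n by (subst ln_ge_iff) auto
  have l: "real l \<le> a" "a - 1 \<le> real l"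
    using a unfolding l_def by linarith+
  have a2: "24 * a \<le> a\<^sup>2" "24 * a\<^sup>2 \<le> a ^ 3"
    using a by (simp_all add: power2_eq_square power3_eq_cube)
  have k: "real k \<le> a\<^sup>2 / 8" "a\<^sup>2 / 8 - 1 \<le> real k"
    using zero_le_power2[of a] unfolding k_def by linarith+
  have "real (2 * k * (l + 2) + l + 3) \<le> real n"
  proof -
    have "real k * (real l + 2) \<le> a\<^sup>2 / 8 * (a + 2)"
      using k l by (intro mult_mono) auto
    then have "2 * (real k * (real l + 2)) \<le> a ^ 3 / 4 + a\<^sup>2 / 2"
      by (simp add: algebra_simps power2_eq_square power3_eq_cube)
    then have "2 * (real k * (real l + 2)) + real l + 3 \<le> a ^ 3"
      using a2 l a by linarith
    then show ?thesis
      by (simp add: a3 algebra_simps)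
  qed
  then have size: "2 * k * (l + 2) + l + 3 \<le> n"
    by (simp only: of_nat_le_iff)
  have k1: "a\<^sup>2 / 16 \<le> real k" "1 \<le> k"
    using k a2 a by linarith+
  show ?thesis
  proof (cases "2 * T \<le> l")
    case True
    have "real (k * k) / 576 \<le> ln (2 * real (card (transcripts C n T)))"
      by (rule radius_approx_transcripts[OF alg k1(2) size M \<alpha>(1) _ _ True])
        (use \<alpha>(2)[of l] size l a in auto)
    also have "\<dots> \<le> 1 + real n * real T * K * L\<^sup>2"
      unfolding K_def L_def using C n by (intro ln_card_transcripts_le) auto
    finally have "real k * real k / 576 \<le> 1 + real n * real T * K * L\<^sup>2"
      by simp
    moreover have "(a\<^sup>2 / 16) * (a\<^sup>2 / 16) \<le> real k * real k"
      using k1 by (intro mult_mono) auto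
    moreover have "(24 :: real) ^ 4 \<le> a ^ 4"
      using a by (intro power_mono) auto
    moreover have "a\<^sup>2 * a\<^sup>2 = a ^ 4"
      by (simp flip: power_add)
    \<comment> \<open>\<open>294912 = 2 * 256 * 576\<close>: as \<open>24 ^ 4\<close> exceeds this
      number, half of the left side absorbs the summand 1.\<close>
    ultimately have "a ^ 4 \<le> 294912 * (real n * real T * K * L\<^sup>2)"
      by (simp add: field_simps)
    then have "a ^ 3 * a \<le> a ^ 3 * (294912 * K * L\<^sup>2 * real T)"
      unfolding a3[symmetric] by (simp add: power_numeral_reduce mult_ac)
    then have "a \<le> 294912 * K * L\<^sup>2 * real T"
      using a by (subst (asm) mult_le_cancel_left_pos) auto
    then have "a / (294912 * K * L\<^sup>2) \<le> real T"
      using K L by (simp add: divide_le_eq mult_ac)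
    then show ?thesis
      by (simp add: a_def K_def L_def)
  next
    case False
    \<comment> \<open>More than \<open>l / 2\<close> rounds are already of order \<open>a\<close>,
      without any communication argument.\<close>
    then have "a / 4 \<le> real T"
      using l a by linarith
    moreover have "a / (294912 * K * L\<^sup>2) \<le> a / 4"
    proof (rule divide_left_mono)
      have "1 \<le> L\<^sup>2"
        using L by (simp add: one_le_power)
      then have "9 * 1 \<le> K * L\<^sup>2"
        using K by (intro mult_mono) auto
      then show "4 \<le> 294912 * K * L\<^sup>2"
        by simp
    qed (use a K L in auto)
    ultimately have "a / (294912 * K * L\<^sup>2) \<le> real T"
      by linarith
    then show ?thesis
      by (simp add: a_def K_def L_def)
  qed
qed

theorem theorem3:
  shows
  "(\<forall>\<epsilon>::real. 0 < \<epsilon> \<and> \<epsilon> \<le> 1/2 \<longrightarrow> (\<forall>C::real. 0 < C \<longrightarrow>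
      (\<exists>c::real. 0 < c \<and> (\<exists>(k::nat) (d::nat) (n0::nat). \<forall>n \<ge> n0. \<forall>(A :: ('s, 'm, 'r) hybrid_alg) (T::nat).
         hybrid_radius_approx A C n T (n ^ d) (3/2 - \<epsilon>) \<longrightarrow>
         real T \<ge> c * real n powr (1/3) / (ln (real n)) ^ k))))
   \<and> (\<forall>C::real. 0 < C \<longrightarrow>
      (\<exists>c::real. 0 < c \<and> (\<exists>(k::nat) (n0::nat). \<forall>n \<ge> n0. \<forall>(A :: ('s, 'm, 'r) hybrid_alg) (T::nat).
         hybrid_radius_approx A C n T 1 1 \<longrightarrow>
         real T \<ge> c * real n powr (1/3) / (ln (real n)) ^ k)))"
proof (intro conjI allI impI)
  fix \<epsilon> C :: real assume \<epsilon>: "0 < \<epsilon> \<and> \<epsilon> \<le> 1/2" and C: "0 < C"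
  \<comment> \<open>From \<open>1 / \<epsilon> \<le> n\<close> follows
    \<open>l \<le> n \<le> \<epsilon> * n^2\<close>, so with \<open>M = n^2\<close> the path length
    \<open>l\<close> is too small to close the gap between \<open>2 * M + l\<close> and
    \<open>3 * M + l\<close>.\<close>
  define n0 where "n0 = max 13824 (nat \<lceil>1 / \<epsilon>\<rceil>)"
  have "1 / (294912 * (2 * C + 3)\<^sup>2) * real n powr (1/3) / (ln (real n)) ^ 2 \<le> real T"
    if n: "n0 \<le> n" and alg: "hybrid_radius_approx A C n T (n ^ 2) (3/2 - \<epsilon>)"
    for n T and A :: "('s, 'm, 'r) hybrid_alg"
  proof (rule radius_approx_rounds[OF alg C, where M = "n ^ 2"])
    show n': "13824 \<le> n"
      using n by (simp add: n0_def)
    then show "1 \<le> n ^ 2"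
      by simp
    show "0 \<le> 3/2 - \<epsilon>"
      using \<epsilon> by simp
    fix l assume "l \<le> n"
    have "1 / \<epsilon> \<le> real n"
      using n unfolding n0_def by linarith
    then have "1 * real n \<le> (\<epsilon> * real n) * real n"
      using \<epsilon> by (intro mult_right_mono) (simp_all add: field_simps)
    then have "real n \<le> \<epsilon> * (real n)\<^sup>2"
      by (simp only: power2_eq_square mult.assoc mult_1)
    moreover have "real l \<le> real n" "0 < real n" "0 \<le> \<epsilon> * real l"
      using \<open>l \<le> n\<close> \<epsilon> n' by simp_all
    ultimately have "real l \<le> \<epsilon> * (real n)\<^sup>2" "0 < \<epsilon> * (real n)\<^sup>2" "0 \<le> \<epsilon> * real l"
      by linarith+
    then show "(3/2 - \<epsilon>) * real (2 * n ^ 2 + l) < real (3 * n ^ 2 + l)"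
      by (simp add: algebra_simps)
  qed simp
  then show "\<exists>c>0. \<exists>k d n0. \<forall>n\<ge>n0. \<forall>(A :: ('s, 'm, 'r) hybrid_alg) T.
      hybrid_radius_approx A C n T (n ^ d) (3/2 - \<epsilon>) \<longrightarrow> c * real n powr (1/3) / ln (real n) ^ k \<le> real T"
    using C by (intro exI[of _ "1 / (294912 * (2 * C + 3)\<^sup>2)"] exI[of _ 2] exI[of _ n0] conjI) auto
next
  fix C :: real assume C: "0 < C"
  \<comment> \<open>With \<open>M = 1\<close> the two cases give radius at most \<open>l + 2\<close>
    and at least \<open>l + 3\<close>, which an exact algorithm tells apart.\<close>
  have "1 / (294912 * (2 * C + 3)\<^sup>2) * real n powr (1/3) / (ln (real n)) ^ 2 \<le> real T"
    if "13824 \<le> n" and alg: "hybrid_radius_approx A C n T 1 1"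
    for n T and A :: "('s, 'm, 'r) hybrid_alg"
    by (rule radius_approx_rounds[OF alg C, where M = 1]) (use that in auto)
  then show "\<exists>c>0. \<exists>k n0. \<forall>n\<ge>n0. \<forall>(A :: ('s, 'm, 'r) hybrid_alg) T.
      hybrid_radius_approx A C n T 1 1 \<longrightarrow> c * real n powr (1/3) / ln (real n) ^ k \<le> real T"
    using C by (intro exI[of _ "1 / (294912 * (2 * C + 3)\<^sup>2)"] exI[of _ 2] exI[of _ 13824] conjI) auto
qed

end
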